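(* Let $\mathbb U_1$ be the Urysohn sphere and $G=\operatorname{Iso}(\mathbb U_1)$ its isometry group, endowed with the topology of pointwise convergence. Then the greatest equivariant compactification of the $G$-space $\mathbb U_1$ is (equivalent to) the Gromov compactification of $\mathbb U_1$. In particular, $\beta_G(\mathbb U_1)$ is metrizable, and the algebra $\operatorname{RUC}_G(\mathbb U_1)$ is the closed unital algebra generated by the set of functions $$\{d(\cdot,z)\colon\mathbb U_1\to[0,1] : z\in\mathbb U_1\}.$$
   Context: Urysohn sphere: $\mathbb U_1$ is the unique (up to isometry) Polish (separable complete) metric space of diameter $1$ that is finitely injective, i.e. for every pair of finite metric spaces $K\subseteq L$ of diameter at most $1$, every isometric embedding $K\to\mathbb U_1$ extends to an isometric embedding $L\to\mathbb U_1$. Equivariant compactifications: a $G$-space is a Tychonoff space $X$ with a continuous left action of the topological group $G$. An equivariant compactification of $X$ is a compact Hausdorff $G$-space $K$ together with a continuous $G$-equivariant map $\nu\colon X\to K$ with dense image. A compactification $\nu'\colon X\to K'$ is a factor of $\nu\colon X\to K$ if there is a continuous $\pi\colon K\to K'$ with $\pi\circ\nu=\nu'$; two compactifications are equivalent if each is a factor of the other. The greatest equivariant compactification $\beta_G\colon X\to\beta_GX$ is the one of which every equivariant compactification is a factor; it corresponds (via Stone--Gelfand duality) to the algebra $\operatorname{RUC}_G(X)$. $\operatorname{RUC}_G(X)$ is the algebra (with the supremum norm) of continuous bounded $f\colon X\to\mathbb R$ such that for every $\varepsilon>0$ there is a neighborhood $V$ of the identity in $G$ with $\sup_{x\in X}|f(vx)-f(x)|<\varepsilon$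 for every $v\in V$. Gromov compactification: for a bounded metric space $(X,d)$ it is the compactification of $X$ corresponding to the closed unital subalgebra of the algebra of bounded continuous real functions on $X$ generated by the functions $x\mapsto d(x,z)$, $z\in X$. *)

theory Defs
  imports "HOL-Analysis.Analysis" "HOL-Algebra.Group_Action"
begin

section \<open>The Urysohn sphere and its isometry group\<close>

text \<open>
  Up to isometry every finite metric space is carried by a set of natural numbers, so it
  suffices to let the finite spaces range over those.
\<close>

definition finitely_injective :: "'a::metric_space itself \<Rightarrow> bool" where
  "finitely_injective _ \<longleftrightarrow>
    (\<forall>(L::nat set) K d (f::nat \<Rightarrow> 'a).
       finite L \<and> Metric_space L d \<and> (\<forall>x\<in>L. \<forall>y\<in>L. d x y \<le> 1) \<and> K \<subseteq> L \<and>
       (\<forall>x\<in>K. \<forall>y\<in>K. dist (f x) (f y) = d x y) \<longrightarrow>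
       (\<exists>h::nat \<Rightarrow> 'a. (\<forall>x\<in>K. h x = f x) \<and> (\<forall>x\<in>L. \<forall>y\<in>L. dist (h x) (h y) = d x y)))"

text \<open>
  Completeness and separability are part of the class \<open>polish_space\<close>.  Boundedness is stated
  separately because \<open>diameter\<close> is a real supremum, unspecified on unbounded sets.
\<close>

definition urysohn_sphere :: "'a::polish_space itself \<Rightarrow> bool" where
  "urysohn_sphere _ \<longleftrightarrow>
    bounded (UNIV::'a set) \<and> diameter (UNIV::'a set) = 1 \<and> finitely_injective TYPE('a)"

definition Iso :: "('a::metric_space \<Rightarrow> 'a) monoid" where
  "Iso = \<lparr>carrier = {g. bij g \<and> (\<forall>x y. dist (g x) (g y) = dist x y)}, mult = (\<circ>), one = id\<rparr>"

definition Iso_topology :: "('a::metric_space \<Rightarrow> 'a) topology" where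
  "Iso_topology = subtopology (product_topology (\<lambda>_. euclidean) UNIV) (carrier Iso)"


section \<open>G-spaces and equivariant compactifications\<close>

definition topological_group :: "('g, 'm) monoid_scheme \<Rightarrow> 'g topology \<Rightarrow> bool" where
  "topological_group G T \<longleftrightarrow>
    group G \<and> topspace T = carrier G \<and>
    continuous_map (prod_topology T T) T (\<lambda>(g, h). g \<otimes>\<^bsub>G\<^esub> h) \<and>
    continuous_map T T (\<lambda>g. inv\<^bsub>G\<^esub> g)"

definition G_space ::
  "('g, 'm) monoid_scheme \<Rightarrow> 'g topology \<Rightarrow> 'x topology \<Rightarrow> ('g \<Rightarrow> 'x \<Rightarrow> 'x) \<Rightarrow> bool" where
  "G_space G T X \<phi> \<longleftrightarrow>
    topological_group G T \<and> completely_regular_space X \<and> Hausdorff_space X \<and>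
    group_action G (topspace X) \<phi> \<and>
    continuous_map (prod_topology T X) X (\<lambda>(g, x). \<phi> g x)"

definition equivariant_compactification ::
  "('g, 'm) monoid_scheme \<Rightarrow> 'g topology \<Rightarrow> 'x topology \<Rightarrow> ('g \<Rightarrow> 'x \<Rightarrow> 'x) \<Rightarrow>
   'k topology \<Rightarrow> ('g \<Rightarrow> 'k \<Rightarrow> 'k) \<Rightarrow> ('x \<Rightarrow> 'k) \<Rightarrow> bool" where
  "equivariant_compactification G T X \<phi> K \<psi> \<nu> \<longleftrightarrow>
    G_space G T X \<phi> \<and> G_space G T K \<psi> \<and> compact_space K \<and>
    continuous_map X K \<nu> \<and>
    (\<forall>g\<in>carrier G. \<forall>x\<in>topspace X. \<nu> (\<phi> g x) = \<psi> g (\<nu> x)) \<and>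
    K closure_of (\<nu> ` topspace X) = topspace K"

text \<open>\<open>compactification_factor X K' \<nu>' K \<nu>\<close>: \<open>\<nu>'\<close> is a factor of \<open>\<nu>\<close>.\<close>

definition compactification_factor ::
  "'x topology \<Rightarrow> 'l topology \<Rightarrow> ('x \<Rightarrow> 'l) \<Rightarrow> 'k topology \<Rightarrow> ('x \<Rightarrow> 'k) \<Rightarrow> bool" where
  "compactification_factor X K' \<nu>' K \<nu> \<longleftrightarrow>
    (\<exists>\<pi>. continuous_map K K' \<pi> \<and> (\<forall>x\<in>topspace X. \<pi> (\<nu> x) = \<nu>' x))"

definition compactification_equivalent ::
  "'x topology \<Rightarrow> 'l topology \<Rightarrow> ('x \<Rightarrow> 'l) \<Rightarrow> 'k topology \<Rightarrow> ('x \<Rightarrow> 'k) \<Rightarrow> bool" where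
  "compactification_equivalent X K' \<nu>' K \<nu> \<longleftrightarrow>
    compactification_factor X K' \<nu>' K \<nu> \<and> compactification_factor X K \<nu> K' \<nu>'"

text \<open>
  A formula cannot quantify over types, so the type \<open>'l\<close> carrying the competing
  compactifications is a parameter.
  For a space \<open>X\<close> with underlying type \<open>'x\<close>, the choice \<open>'l = ('x \<Rightarrow>\<^sub>C real) \<Rightarrow> real\<close> already
  covers every compactification up to equivalence, since each one is the character space of
  an algebra of bounded continuous functions on \<open>X\<close> (see \<open>character_topology\<close> below).
\<close>

definition greatest_equivariant_compactification ::
  "'l itself \<Rightarrow> ('g, 'm) monoid_scheme \<Rightarrow> 'g topology \<Rightarrow> 'x topology \<Rightarrow> ('g \<Rightarrow> 'x \<Rightarrow> 'x) \<Rightarrow>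
   'k topology \<Rightarrow> ('g \<Rightarrow> 'k \<Rightarrow> 'k) \<Rightarrow> ('x \<Rightarrow> 'k) \<Rightarrow> bool" where
  "greatest_equivariant_compactification _ G T X \<phi> K \<psi> \<nu> \<longleftrightarrow>
    equivariant_compactification G T X \<phi> K \<psi> \<nu> \<and>
    (\<forall>(K'::'l topology) \<psi>' \<nu>'.
       equivariant_compactification G T X \<phi> K' \<psi>' \<nu>' \<longrightarrow> compactification_factor X K' \<nu>' K \<nu>)"


section \<open>Function algebras and their compactifications\<close>

definition RUC ::
  "('g, 'm) monoid_scheme \<Rightarrow> 'g topology \<Rightarrow> ('g \<Rightarrow> 'x \<Rightarrow> 'x) \<Rightarrow> ('x::topological_space \<Rightarrow>\<^sub>C real) set" where
  "RUC G T \<phi> =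
    {f :: 'x \<Rightarrow>\<^sub>C real. \<forall>\<epsilon>>0. \<exists>V. openin T V \<and> \<one>\<^bsub>G\<^esub> \<in> V \<and>
       (\<forall>v\<in>V. (SUP x. \<bar>f (\<phi> v x) - f x\<bar>) < \<epsilon>)}"

definition times_bcontfun ::
  "('a::topological_space \<Rightarrow>\<^sub>C real) \<Rightarrow> ('a \<Rightarrow>\<^sub>C real) \<Rightarrow> 'a \<Rightarrow>\<^sub>C real" where
  "times_bcontfun f g = Bcontfun (\<lambda>x. f x * g x)"

lemma apply_times_bcontfun [simp]: "apply_bcontfun (times_bcontfun f g) x = f x * g x"
proof -
  have "norm (f x * g x) \<le> norm f * norm g" for x
    unfolding norm_mult by (intro mult_mono norm_bounded) auto
  then have "(\<lambda>x. f x * g x) \<in> bcontfun"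
    by (intro bcontfun_normI continuous_on_mult) auto
  then show ?thesis
    by (simp add: times_bcontfun_def Bcontfun_inverse)
qed

definition unital_subalgebra :: "('a::topological_space \<Rightarrow>\<^sub>C real) set \<Rightarrow> bool" where
  "unital_subalgebra A \<longleftrightarrow>
    subspace A \<and> const_bcontfun 1 \<in> A \<and> (\<forall>f\<in>A. \<forall>g\<in>A. times_bcontfun f g \<in> A)"

definition closed_unital_algebra_generated ::
  "('a::topological_space \<Rightarrow>\<^sub>C real) set \<Rightarrow> ('a \<Rightarrow>\<^sub>C real) set" where
  "closed_unital_algebra_generated S = (\<lambda>A. unital_subalgebra A \<and> closed A) hull S"

text \<open>
  The compactification that Stone--Gelfand duality assigns to an algebra \<open>A\<close>: the space of its
  characters with the topology of pointwise convergence on \<open>A\<close>, and the evaluation map.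
\<close>

definition characters :: "('a::topological_space \<Rightarrow>\<^sub>C real) set \<Rightarrow> (('a \<Rightarrow>\<^sub>C real) \<Rightarrow> real) set" where
  "characters A =
    {\<xi> \<in> extensional A. \<xi> (const_bcontfun 1) = 1 \<and>
       (\<forall>f\<in>A. \<forall>c. \<xi> (c *\<^sub>R f) = c * \<xi> f) \<and>
       (\<forall>f\<in>A. \<forall>g\<in>A. \<xi> (f + g) = \<xi> f + \<xi> g \<and> \<xi> (times_bcontfun f g) = \<xi> f * \<xi> g)}"

definition character_topology ::
  "('a::topological_space \<Rightarrow>\<^sub>C real) set \<Rightarrow> (('a \<Rightarrow>\<^sub>C real) \<Rightarrow> real) topology" where
  "character_topology A = subtopology (product_topology (\<lambda>_. euclideanreal) A) (characters A)"

definition evaluation ::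
  "('a::topological_space \<Rightarrow>\<^sub>C real) set \<Rightarrow> 'a \<Rightarrow> ('a \<Rightarrow>\<^sub>C real) \<Rightarrow> real" where
  "evaluation A x = (\<lambda>f\<in>A. apply_bcontfun f x)"

text \<open>
  The set of generators contains every function \<open>dist _ z\<close> as soon as the metric is bounded;
  the three definitions below are meant for bounded metric spaces only.
\<close>

definition gromov_algebra :: "('a::metric_space \<Rightarrow>\<^sub>C real) set" where
  "gromov_algebra =
    closed_unital_algebra_generated {f. \<exists>z. apply_bcontfun f = (\<lambda>x. dist x z)}"

definition gromov_compactification :: "(('a::metric_space \<Rightarrow>\<^sub>C real) \<Rightarrow> real) topology" where
  "gromov_compactification = character_topology gromov_algebra"

definition gromov_map :: "'a::metric_space \<Rightarrow> ('a \<Rightarrow>\<^sub>C real) \<Rightarrow> real" where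
  "gromov_map = evaluation gromov_algebra"

end

theory Submission
  imports Defs
begin

text \<open>
  Let \<open>f\<close> be in \<open>RUC\<close>.  Some pointwise neighbourhood of the identity, given by finitely many
  points \<open>a\<^sub>i\<close>, moves \<open>f\<close> by at most \<open>\<epsilon>\<close>.  If \<open>x\<close> and \<open>y\<close> have nearly the same distances
  to the \<open>a\<^sub>i\<close>, then finite injectivity gives points \<open>a\<^sub>i'\<close> close to \<open>a\<^sub>i\<close> such that
  \<open>a\<^sub>i \<mapsto> a\<^sub>i'\<close>, \<open>x \<mapsto> y\<close> preserves distances, and by ultrahomogeneity this partial isometry extends
  to an isometry in that neighbourhood; hence \<open>\<bar>f x - f y\<bar> \<le> \<epsilon>\<close>.  So \<open>f\<close> is uniformly continuous
  for the uniformity generated by the functions \<open>dist _ z\<close>, and lattice operations on these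
  approximate \<open>f\<close>.  Thus \<open>RUC\<close> is the Gromov algebra, whose character space is the greatest
  equivariant compactification because functions pulled back from any other equivariant
  compactification lie in \<open>RUC\<close>.  It is metrizable since countably many \<open>dist _ z\<close> suffice.
\<close>

section \<open>Homogeneity of the Urysohn sphere\<close>

text \<open>The displacement must not accumulate while the finitely many points are treated one at a
  time. Once \<open>x\<close> is sent exactly to \<open>y\<close>, a new point \<open>q\<close>
  needs an image at prescribed distances from the images already chosen. The triangle inequality
  forces \<open>q\<close> to move at least by the largest discrepancy
  \<open>\<bar>dist q a - dist q b\<bar>\<close> over the pairs \<open>(a, b)\<close> so far, and
  finite injectivity attains this bound. The discrepancy is at most \<open>\<delta>\<close> for
  \<open>(x, y)\<close> by hypothesis, and for each earlier pair because its own point moved by at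
  most \<open>\<delta>\<close>.

  Partial isometries are relations: the backward step of back and forth is then the forward step for
  the converse, and passing to the whole space is a closure in the product.

  Characters are purely algebraic, and what is needed about them flows from one fact: on finitely
  many functions a character is approximated by evaluation at a point. It yields the norm bound,
  hence compactness, as well as the density of the evaluations and the factor maps.\<close>

definition partial_isometry :: "('a::metric_space \<times> 'b::metric_space) set \<Rightarrow> bool" where
  "partial_isometry R \<longleftrightarrow> (\<forall>a b c d. (a, b) \<in> R \<longrightarrow> (c, d) \<in> R \<longrightarrow> dist a c = dist b d)"

lemma partial_isometryD:
  "partial_isometry R \<Longrightarrow> (a, b) \<in> R \<Longrightarrow> (c, d) \<in> R \<Longrightarrow> dist a c = dist b d"
  unfolding partial_isometry_def by blast

lemma partial_isometry_insert:
  assumes "partial_isometry R" and "\<And>c d. (c, d) \<in> R \<Longrightarrow> dist a c = dist b d"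
  shows "partial_isometry (insert (a, b) R)"
proof -
  have "dist c a = dist d b" if "(c, d) \<in> R" for c d
    using assms(2)[OF that] by (simp add: dist_commute)
  then show ?thesis
    using assms unfolding partial_isometry_def by auto
qed

lemma partial_isometry_converse: "partial_isometry (R\<inverse>) \<longleftrightarrow> partial_isometry R"
  unfolding partial_isometry_def converse_iff by metis

lemma partial_isometry_closure:
  assumes "partial_isometry R"
  shows "partial_isometry (closure R)"
proof -
  have "dist (fst p) (fst q) = dist (snd p) (snd q)" if p: "p \<in> closure R" and q: "q \<in> closure R" for p q
  proof -
    obtain u where u: "\<forall>n. u n \<in> R" "u \<longlonglongrightarrow> p"
      using p unfolding closure_sequential by blast
    obtain v where v: "\<forall>n. v n \<in> R" "v \<longlonglongrightarrow> q"
      using q unfolding closure_sequential by blast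
    have "(\<lambda>n. dist (fst (u n)) (fst (v n))) \<longlonglongrightarrow> dist (fst p) (fst q)"
      by (intro tendsto_intros u v)
    moreover have "(\<lambda>n. dist (snd (u n)) (snd (v n))) \<longlonglongrightarrow> dist (snd p) (snd q)"
      by (intro tendsto_intros u v)
    moreover have "dist (fst (u n)) (fst (v n)) = dist (snd (u n)) (snd (v n))" for n
      using partial_isometryD[OF assms, of "fst (u n)" "snd (u n)" "fst (v n)" "snd (v n)"]
        u(1)[rule_format, of n] v(1)[rule_format, of n] by simp
    ultimately show ?thesis
      using LIMSEQ_unique by simp
  qed
  then show ?thesis
    by (fastforce simp: partial_isometry_def)
qed

text \<open>Completeness enters here: along a sequence of the domain converging to \<open>x\<close>,
  the partners have the same mutual distances, so they form a Cauchy sequence, and their limit is a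
  partner of \<open>x\<close>.\<close>

lemma Domain_closure_partial_isometry:
  fixes R :: "('a::metric_space \<times> 'b::complete_space) set"
  assumes R: "partial_isometry R" and dense: "closure (Domain R) = UNIV"
  shows "Domain (closure R) = UNIV"
proof -
  have "\<exists>y. (x, y) \<in> closure R" for x
  proof -
    obtain u where u: "\<forall>n. u n \<in> Domain R" "u \<longlonglongrightarrow> x"
      using dense closure_sequential[of x "Domain R"] by auto
    then have "\<forall>n. \<exists>b. (u n, b) \<in> R" by blast
    then obtain v where v: "\<And>n. (u n, v n) \<in> R" by metis
    have "dist (v m) (v n) = dist (u m) (u n)" for m n
      using partial_isometryD[OF R v v] by simp
    then have "Cauchy v"
      using LIMSEQ_imp_Cauchy[OF u(2)] by (simp add: Cauchy_def)
    then obtain y where "v \<longlonglongrightarrow> y"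
      using Cauchy_convergent_iff convergent_def by blast
    then have "(\<lambda>n. (u n, v n)) \<longlonglongrightarrow> (x, y)"
      using u(2) by (intro tendsto_Pair)
    then show ?thesis
      unfolding closure_sequential using v by (intro exI[of _ y] exI[of _ "\<lambda>n. (u n, v n)"]) simp
  qed
  then show ?thesis by auto
qed

lemma Iso_carrier_iff:
  "g \<in> carrier Iso \<longleftrightarrow> bij g \<and> (\<forall>x y. dist (g x) (g y) = dist x y)"
  by (simp add: Iso_def)

text \<open>The closure of \<open>R\<close> is the graph of the isometry: total by density of the
  domain, onto by the same argument for the converse, and single-valued because points at distance 0
  have partners at distance 0.\<close>

lemma dense_partial_isometry_extends_to_Iso:
  fixes R :: "('a::complete_space \<times> 'a) set"
  assumes R: "partial_isometry R" and "closure (Domain R) = UNIV" "closure (Range R) = UNIV"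
  shows "\<exists>g\<in>carrier Iso. \<forall>a b. (a, b) \<in> R \<longrightarrow> g a = b"
proof -
  let ?C = "closure R"
  have C: "partial_isometry ?C"
    using partial_isometry_closure[OF R] .
  \<comment> \<open>Closure commutes with converse, so totality of the closed converse becomes
    surjectivity.\<close>
  have swap: "(y, x) \<in> ?C" if xy: "(x, y) \<in> closure (R\<inverse>)" for x y
  proof -
    obtain u where u: "\<forall>n. u n \<in> R\<inverse>" "u \<longlonglongrightarrow> (x, y)"
      using xy unfolding closure_sequential by blast
    then have "(\<lambda>n. (snd (u n), fst (u n))) \<longlonglongrightarrow> (y, x)"
      by (auto intro!: tendsto_Pair dest: tendsto_fst tendsto_snd)
    moreover have "(snd (u n), fst (u n)) \<in> R" for n
      using u(1)[rule_format, of n] by (simp add: converse_unfold split_beta)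
    ultimately show ?thesis
      unfolding closure_sequential by (intro exI[of _ "\<lambda>n. (snd (u n), fst (u n))"]) simp
  qed
  have "Domain (closure (R\<inverse>)) = UNIV"
    using Domain_closure_partial_isometry[of "R\<inverse>"] assms by (simp add: partial_isometry_converse)
  then have ran: "\<exists>x. (x, y) \<in> ?C" for y
    using swap by (metis Domain.cases UNIV_I)
  have "\<exists>y. (x, y) \<in> ?C" for x
    using Domain_closure_partial_isometry[OF assms(1,2)] by auto
  then obtain g where g: "\<And>x. (x, g x) \<in> ?C"
    by metis
  have iso: "dist (g x) (g y) = dist x y" for x y
    using partial_isometryD[OF C g g] by simp
  have val: "g a = b" if "(a, b) \<in> ?C" for a b
    using partial_isometryD[OF C that g[of a]] by simp
  have "inj g"
    using iso by (metis dist_eq_0_iff injI)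
  moreover have "surj g"
    using ran val by (metis surjI)
  ultimately have "g \<in> carrier Iso"
    using iso by (simp add: Iso_carrier_iff bij_def)
  then show ?thesis
    using val[OF subsetD[OF closure_subset]] by auto
qed

section \<open>One-point extensions and ultrahomogeneity of the Urysohn sphere\<close>

context
  assumes U: "urysohn_sphere TYPE('a::polish_space)"
begin

lemma urysohn_dist_le_1: "dist (x::'a) y \<le> 1"
  using U diameter_bounded_bound[of "UNIV::'a set" x y] by (simp add: urysohn_sphere_def)

text \<open>\<open>kat\<close> is the condition of a Katetov function: adding to \<open>S\<close>
  one point at distances \<open>k\<close> keeps the triangle inequality. Finite injectivity speaks
  of metrics on natural numbers, so \<open>S\<close> is enumerated by the indices below
  \<open>n\<close>, and \<open>n\<close> itself is the new point.\<close>

lemma urysohn_one_point_extension: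
  fixes S :: "'a set" and k :: "'a \<Rightarrow> real"
  assumes S: "finite S" and k: "\<And>s. s \<in> S \<Longrightarrow> 0 \<le> k s \<and> k s \<le> 1"
    and kat: "\<And>s t. s \<in> S \<Longrightarrow> t \<in> S \<Longrightarrow> k s \<le> k t + dist s t \<and> dist s t \<le> k s + k t"
  shows "\<exists>p. \<forall>s\<in>S. dist p s = k s"
\<comment> \<open>A zero of \<open>k\<close> would make the extended distance a mere pseudometric;
  in that case the zero itself already realises \<open>k\<close>.\<close>
proof (cases "\<exists>s\<in>S. k s = 0")
  case True
  then obtain s where s: "s \<in> S" "k s = 0" by blast
  have "dist s t = k t" if "t \<in> S" for t
    using kat[OF s(1) that] kat[OF that s(1)] s by (simp add: dist_commute)
  then show ?thesis by blast
next
  case False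
  define n where "n = card S"
  obtain e where e: "bij_betw e {..<n} S"
    using S ex_bij_betw_nat_finite[of S] by (auto simp: n_def atLeast0LessThan)
  \<comment> \<open>The zeros for indices above \<open>n\<close> matter: nonnegativity and symmetry
    in \<open>Metric_space\<close> are demanded for all arguments, also outside the carrier.\<close>
  define d where "d i j = (if i = n then (if j = n then 0 else if j < n then k (e j) else 0)
                    else if j = n then (if i < n then k (e i) else 0) else dist (e i) (e j))" for i j
  have eS: "e i \<in> S" if "i < n" for i
    using e that by (auto simp: bij_betw_def)
  have pos: "0 < k (e i)" "k (e i) \<le> 1" if "i < n" for i
    using False eS[OF that] k[of "e i"] by (auto simp: order_less_le)
  have inj: "e i = e j \<longleftrightarrow> i = j" if "i < n" "j < n" for i j
    using e that by (auto simp: bij_betw_def inj_on_eq_iff)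
  have kat': "k (e i) \<le> k (e j) + dist (e i) (e j)" "dist (e i) (e j) \<le> k (e i) + k (e j)"
    if "i < n" "j < n" for i j
    using kat eS that by blast+
  note fi = U[unfolded urysohn_sphere_def finitely_injective_def, THEN conjunct2, THEN conjunct2]
  have "Metric_space {..n} d"
  proof
    show "0 \<le> d i j" for i j
      using pos by (auto simp: d_def less_imp_le)
    show "d i j = d j i" for i j
      by (auto simp: d_def dist_commute)
    show "d i j = 0 \<longleftrightarrow> i = j" if "i \<in> {..n}" "j \<in> {..n}" for i j
      using that pos[of i] pos[of j] inj[of i j] by (auto simp: d_def)
    show "d i l \<le> d i j + d j l" if "i \<in> {..n}" "j \<in> {..n}" "l \<in> {..n}" for i j l
      using that pos[of i] pos[of j] kat'[of i l] kat'[of i j] kat'[of j l] kat'[of l j]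
      by (auto simp: d_def dist_commute dist_triangle)
  qed
  moreover have "\<forall>i\<in>{..n}. \<forall>j\<in>{..n}. d i j \<le> 1"
    using pos by (auto simp: d_def urysohn_dist_le_1)
  moreover have "\<forall>i\<in>{..<n}. \<forall>j\<in>{..<n}. dist (e i) (e j) = d i j"
    by (auto simp: d_def)
  moreover have "finite {..n}" "{..<n} \<subseteq> {..n}" by auto
  ultimately obtain h where h: "\<forall>i\<in>{..<n}. h i = e i"
      "\<forall>i\<in>{..n}. \<forall>j\<in>{..n}. dist (h i) (h j) = d i j"
    using fi[THEN spec[of _ "{..n}"], THEN spec[of _ "{..<n}"], THEN spec[of _ d], THEN spec[of _ e]] by blast
  have "dist (h n) s = k s" if s: "s \<in> S" for s
  proof -
    obtain i where "i < n" "e i = s"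
      using e s by (auto simp: bij_betw_def)
    then show ?thesis
      using h(1)[rule_format, of i] h(2)[rule_format, of n i] by (simp add: d_def)
  qed
  then show ?thesis by blast
qed

text \<open>The image of \<open>q\<close> is a one-point extension over the range of
  \<open>R\<close> together with \<open>q\<close> itself. The distance prescribed to
  \<open>q\<close> is the largest discrepancy \<open>m\<close>, the smallest value that the triangle
  inequality allows; the work is to check that the prescription is a Katetov function.\<close>

lemma urysohn_small_displacement_extension:
  fixes R :: "('a \<times> 'a) set" and q :: 'a
  assumes R: "finite R" "partial_isometry R"
    and near: "\<And>a b. (a, b) \<in> R \<Longrightarrow> \<bar>dist q a - dist q b\<bar> \<le> \<delta>" and "0 \<le> \<delta>"
  shows "\<exists>q'. partial_isometry (insert (q, q') R) \<and> dist q q' \<le> \<delta>"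
proof (cases "R = {}")
  case True
  then have "partial_isometry (insert (q, q) R) \<and> dist q q \<le> \<delta>"
    using \<open>0 \<le> \<delta>\<close> by (simp add: partial_isometry_def)
  then show ?thesis by blast
next
  case False
  define V where "V = (\<lambda>(a, b). \<bar>dist q a - dist q b\<bar>) ` R"
  define m where "m = Max V"
  have V: "finite V" "V \<noteq> {}" using R False by (auto simp: V_def)
  have m_ge: "\<bar>dist q a - dist q b\<bar> \<le> m" if "(a, b) \<in> R" for a b
    unfolding m_def by (rule Max_ge[OF V(1)]) (use that in \<open>force simp: V_def\<close>)
  obtain a0 b0 where m0: "(a0, b0) \<in> R" "m = \<bar>dist q a0 - dist q b0\<bar>"
    using Max_in[OF V] by (auto simp: V_def m_def)
  have inj: "a = a'" if "(a, b) \<in> R" "(a', b) \<in> R" for a a' b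
    using partial_isometryD[OF R(2) that] by simp
  \<comment> \<open>By \<open>inj\<close> the preimage of \<open>s\<close> is unique, so the
    description is well defined. The default \<open>m\<close> concerns only \<open>s = q\<close>
    when \<open>q\<close> is not in the range of \<open>R\<close>.\<close>
  define k where "k s = (if \<exists>a. (a, s) \<in> R then dist q (THE a. (a, s) \<in> R) else m)" for s
  have kR: "k b = dist q a" if "(a, b) \<in> R" for a b
    using that inj by (auto simp: k_def intro!: arg_cong[where f="dist q"] the_equality)
  \<comment> \<open>If \<open>q\<close> already lies in the range, with
    \<open>(a, q) \<in> R\<close>, its image is at distance \<open>dist q a\<close> from
    \<open>q\<close>. This agrees with \<open>m\<close>: it is one of the discrepancies, and
    \<open>dist a a0 = dist q b0\<close> bounds the maximal one by it.\<close>
  have kq: "k q = m"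
  proof (cases "\<exists>a. (a, q) \<in> R")
    case True
    then obtain a where a: "(a, q) \<in> R" by blast
    have "dist q a \<le> m" using m_ge[OF a] by simp
    moreover have "m \<le> dist q a"
    proof -
      have "dist a a0 = dist q b0" using partial_isometryD[OF R(2) a m0(1)] .
      then show ?thesis using m0(2) by metric
    qed
    ultimately show ?thesis using kR[OF a] by simp
  qed (simp add: k_def)
  have "\<exists>p. \<forall>s\<in>insert q (Range R). dist p s = k s"
  proof (rule urysohn_one_point_extension)
    show "finite (insert q (Range R))"
      using R(1) by (simp add: finite_Range)
    show "0 \<le> k s \<and> k s \<le> 1" if "s \<in> insert q (Range R)" for s
    proof (cases "s \<in> Range R")
      case True
      then show ?thesis by (auto simp: kR urysohn_dist_le_1)
    next
      case False
      then have "s = q" using that by simp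
      have "dist q a0 \<le> 1" "dist q b0 \<le> 1" by (simp_all add: urysohn_dist_le_1)
      then have "0 \<le> m \<and> m \<le> 1"
        unfolding m0(2) abs_if using zero_le_dist[of q a0] zero_le_dist[of q b0]
        by (simp del: zero_le_dist)
      then show ?thesis by (simp add: \<open>s = q\<close> kq)
    qed
    have RR: "k b \<le> k d + dist b d \<and> dist b d \<le> k b + k d" if "(a, b) \<in> R" "(c, d) \<in> R" for a b c d
    proof -
      have "dist a c = dist b d" using partial_isometryD[OF R(2) that] .
      then show ?thesis
        unfolding kR[OF that(1)] kR[OF that(2)]
        using dist_triangle[of q a c] dist_triangle[of a c q] by (simp add: dist_commute)
    qed
    have Rq: "k b \<le> m + dist b q \<and> m \<le> k b + dist b q \<and> dist b q \<le> k b + m"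
      if "(a, b) \<in> R" for a b
    proof -
      have 1: "dist a a0 = dist b b0" using partial_isometryD[OF R(2) that m0(1)] .
      have 2: "\<bar>dist q a - dist q b\<bar> \<le> m" using m_ge[OF that] .
      \<comment> \<open>Pass from \<open>a0\<close> to \<open>a\<close> and from \<open>b0\<close>
        to \<open>b\<close>: the contributions \<open>dist a a0\<close> and \<open>dist b b0\<close>
        are equal and cancel in the difference.\<close>
      have "m \<le> dist q a + dist b q"
        unfolding m0(2) using 1 dist_triangle[of q a0 a] dist_triangle[of q b0 b]
          dist_triangle[of a a0 q] dist_triangle[of b b0 q] by (auto simp: dist_commute abs_le_iff)
      with 2 show ?thesis
        unfolding kR[OF that] by (auto simp: dist_commute)
    qed
    have m0': "0 \<le> m" using m0 by simp
    show "k s \<le> k t + dist s t \<and> dist s t \<le> k s + k t"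
      if st: "s \<in> insert q (Range R)" "t \<in> insert q (Range R)" for s t
    proof -
      consider "s = q" "t = q" | a where "s = q" "(a, t) \<in> R" | a where "t = q" "(a, s) \<in> R"
        | a c where "(a, s) \<in> R" "(c, t) \<in> R"
        using st by auto
      then show ?thesis
      proof cases
        case 1
        then show ?thesis using m0' by (simp add: kq)
      next
        case (2 a)
        show ?thesis using Rq[OF 2(2)] by (simp add: kq 2(1) dist_commute add.commute)
      next
        case (3 a)
        then show ?thesis using Rq[OF 3(2)] by (simp add: kq)
      next
        case (4 a c)
        then show ?thesis using RR by blast
      qed
    qed
  qed
  then obtain p where p: "\<And>s. s \<in> insert q (Range R) \<Longrightarrow> dist p s = k s" by blast
  have "partial_isometry (insert (q, p) R)"
  proof (rule partial_isometry_insert[OF R(2)])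
    show "dist q c = dist p d" if "(c, d) \<in> R" for c d
      using kR[OF that] p[of d] RangeI[OF that] by simp
  qed
  moreover have "dist q p \<le> \<delta>"
    using p[of q] kq near[OF m0(1)] m0(2) by (simp add: dist_commute)
  ultimately show ?thesis by blast
qed

text \<open>With all distances in the unit interval, every discrepancy is at most 1, so the
  controlled extension applies with \<open>\<delta> = 1\<close>.\<close>

lemma urysohn_extension:
  fixes R :: "('a \<times> 'a) set"
  assumes R: "finite R" "partial_isometry R"
  shows "\<exists>q'. partial_isometry (insert (q, q') R)"
proof -
  have "\<bar>dist q a - dist q b\<bar> \<le> 1" for a b
    using urysohn_dist_le_1[of q a] urysohn_dist_le_1[of q b] zero_le_dist[of q a] zero_le_dist[of q b]
    by linarith
  then show ?thesis
    using urysohn_small_displacement_extension[OF R, of q 1] by auto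
qed

text \<open>Back and forth along a countable dense set.\<close>

lemma urysohn_ultrahomogeneous:
  fixes R :: "('a \<times> 'a) set"
  assumes R: "finite R" "partial_isometry R"
  shows "\<exists>g\<in>carrier Iso. \<forall>a b. (a, b) \<in> R \<longrightarrow> g a = b"
proof -
  obtain D :: "'a set" where D: "countable D" "\<And>X. open X \<Longrightarrow> X \<noteq> {} \<Longrightarrow> \<exists>d\<in>D. d \<in> X"
    using countable_dense_setE by blast
  have clD: "closure D = UNIV"
    using D(2)[of "- closure D"] closure_subset[of D] by (auto simp: open_Compl)
  then have "D \<noteq> {}" by auto
  then have z: "range (from_nat_into D) = D"
    using D(1) by (rule range_from_nat_into)
  define z where "z = from_nat_into D"
  let ?P = "\<lambda>R. finite R \<and> partial_isometry R"
  have step: "\<exists>S. ?P S \<and> Q \<subseteq> S \<and> z n \<in> Domain S \<and> z n \<in> Range S" if Q: "?P Q" for Q n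
  proof -
    obtain q where q: "partial_isometry (insert (z n, q) Q)"
      using urysohn_extension Q by blast
    let ?Q = "insert (z n, q) Q"
    \<comment> \<open>Backward step: extending the converse to \<open>z n\<close> puts
      \<open>z n\<close> into the range.\<close>
    have "\<exists>p. partial_isometry (insert (z n, p) (?Q\<inverse>))"
      by (rule urysohn_extension) (use q Q in \<open>auto simp: partial_isometry_converse\<close>)
    then obtain p where "partial_isometry (insert (z n, p) (?Q\<inverse>))" by blast
    moreover have "insert (z n, p) (?Q\<inverse>) = (insert (p, z n) ?Q)\<inverse>" by auto
    ultimately have "partial_isometry (insert (p, z n) ?Q)"
      by (metis partial_isometry_converse)
    then show ?thesis
      using Q by (intro exI[of _ "insert (p, z n) ?Q"]) auto
  qed
  \<comment> \<open>The clause for \<open>n = 0\<close> makes the chain start at \<open>R\<close>,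
    so that its union extends \<open>R\<close>.\<close>
  have "\<exists>Q. \<forall>n. (?P (Q n) \<and> (n = 0 \<longrightarrow> Q n = R)) \<and>
      (Q n \<subseteq> Q (Suc n) \<and> z n \<in> Domain (Q (Suc n)) \<and> z n \<in> Range (Q (Suc n)))"
    by (rule dependent_nat_choice) (use step R in auto)
  then obtain Q where Q': "\<forall>n. (?P (Q n) \<and> (n = 0 \<longrightarrow> Q n = R)) \<and>
      (Q n \<subseteq> Q (Suc n) \<and> z n \<in> Domain (Q (Suc n)) \<and> z n \<in> Range (Q (Suc n)))" ..
  then have Q: "\<And>n. ?P (Q n)" "Q 0 = R"
      "\<And>n. Q n \<subseteq> Q (Suc n) \<and> z n \<in> Domain (Q (Suc n)) \<and> z n \<in> Range (Q (Suc n))"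
    by simp_all
  let ?U = "\<Union>n. Q n"
  have mono: "Q m \<subseteq> Q n" if "m \<le> n" for m n
    using lift_Suc_mono_le[of Q, OF _ that] Q(3) by simp
  have "partial_isometry ?U"
    unfolding partial_isometry_def
  proof clarify
    fix a b c d m n
    assume "(a, b) \<in> Q m" "(c, d) \<in> Q n"
    then have "(a, b) \<in> Q (max m n)" "(c, d) \<in> Q (max m n)"
      using subsetD[OF mono[of m "max m n"]] subsetD[OF mono[of n "max m n"]] by auto
    then show "dist a c = dist b d"
      using Q(1)[of "max m n"] by (intro partial_isometryD[of "Q (max m n)"]) auto
  qed
  moreover have "D \<subseteq> Domain ?U \<and> D \<subseteq> Range ?U"
  proof -
    have "z n \<in> Domain ?U \<and> z n \<in> Range ?U" for n
      using Q(3)[of n] by blast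
    then show ?thesis
      using z unfolding z_def by (metis image_subset_iff)
  qed
  then have "closure (Domain ?U) = UNIV" "closure (Range ?U) = UNIV"
    using closure_mono[of D] clD by auto
  ultimately obtain g where "g \<in> carrier Iso" "\<forall>a b. (a, b) \<in> ?U \<longrightarrow> g a = b"
    using dense_partial_isometry_extends_to_Iso by blast
  then show ?thesis
    using Q(2) by (intro bexI[of _ g]) auto
qed

text \<open>The pair \<open>(x, y)\<close> is put in first, and the points of \<open>F\<close>
  follow one by one. A new \<open>q\<close> sees a discrepancy of at most \<open>\<delta>\<close> at
  \<open>(x, y)\<close> by \<open>near\<close>, and at an earlier pair \<open>(a, b)\<close> because
  it is at most \<open>dist a b\<close>; hence the same \<open>\<delta>\<close> serves at every
  stage.\<close>

lemma urysohn_approximate_homogeneity: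
  fixes x y :: 'a and F :: "'a set"
  assumes F: "finite F" and near: "\<And>a. a \<in> F \<Longrightarrow> \<bar>dist x a - dist y a\<bar> \<le> \<delta>" and "0 \<le> \<delta>"
  shows "\<exists>g\<in>carrier Iso. g x = y \<and> (\<forall>a\<in>F. dist (g a) a \<le> \<delta>)"
proof -
  have "\<exists>R. finite R \<and> partial_isometry R \<and> (x, y) \<in> R \<and> F \<subseteq> Domain R \<and>
    R \<subseteq> insert (x, y) {(a, b). dist a b \<le> \<delta>}"
    using F near
  proof (induction F)
    case empty
    then show ?case by (intro exI[of _ "{(x, y)}"]) (simp add: partial_isometry_def)
  next
    case (insert q F)
    obtain R where R: "finite R" "partial_isometry R" "(x, y) \<in> R" "F \<subseteq> Domain R"
      "R \<subseteq> insert (x, y) {(a, b). dist a b \<le> \<delta>}"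
      using insert.IH insert.prems by blast
    have "\<bar>dist q a - dist q b\<bar> \<le> \<delta>" if "(a, b) \<in> R" for a b
    proof -
      have "\<bar>dist q a - dist q b\<bar> \<le> dist a b" by metric
      then show ?thesis
        using R(5) that insert.prems[of q] by (auto simp: dist_commute)
    qed
    then obtain q' where q': "partial_isometry (insert (q, q') R)" "dist q q' \<le> \<delta>"
      using urysohn_small_displacement_extension[OF R(1,2) _ \<open>0 \<le> \<delta>\<close>] by blast
    then show ?case
      using R by (intro exI[of _ "insert (q, q') R"]) auto
  qed
  then obtain R where R: "finite R" "partial_isometry R" "(x, y) \<in> R" "F \<subseteq> Domain R"
      "R \<subseteq> insert (x, y) {(a, b). dist a b \<le> \<delta>}" by blast
  obtain g where g: "g \<in> carrier Iso" "\<And>a b. (a, b) \<in> R \<Longrightarrow> g a = b"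
    using urysohn_ultrahomogeneous[OF R(1,2)] by blast
  have "dist (g a) a \<le> \<delta>" if "a \<in> F" for a
  proof -
    from that R(4) obtain b where b: "(a, b) \<in> R" by blast
    \<comment> \<open>When \<open>a\<close> is \<open>x\<close>, the pair can be
      \<open>(x, y)\<close>; then \<open>near\<close> at \<open>a = x\<close> says that
      \<open>dist y x \<le> \<delta>\<close>.\<close>
    then show ?thesis
      using R(5) b g(2)[OF b] near[OF that] 
      by (auto simp: dist_commute)
  qed
  then show ?thesis
    using g R(3) by blast
qed

end

section \<open>Closed unital algebras of bounded continuous functions\<close>

definition closed_unital_algebra :: "('a::topological_space \<Rightarrow>\<^sub>C real) set \<Rightarrow> bool" where
  "closed_unital_algebra A \<longleftrightarrow> unital_subalgebra A \<and> closed A"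

lemma closed_unital_algebra_generated:
  "closed_unital_algebra (closed_unital_algebra_generated S)"
proof -
  have "unital_subalgebra (\<Inter>T) \<and> closed (\<Inter>T)"
    if "\<And>A. A \<in> T \<Longrightarrow> unital_subalgebra A \<and> closed A" for T :: "('a \<Rightarrow>\<^sub>C real) set set"
    using that unfolding unital_subalgebra_def by (auto intro: subspace_Inter)
  then show ?thesis
    unfolding closed_unital_algebra_def closed_unital_algebra_generated_def
    by (intro hull_in[where S="\<lambda>A. unital_subalgebra A \<and> closed A"]) blast
qed

lemma closed_unital_algebra_generated_minimal:
  "S \<subseteq> A \<Longrightarrow> closed_unital_algebra A \<Longrightarrow> closed_unital_algebra_generated S \<subseteq> A"
  unfolding closed_unital_algebra_generated_def closed_unital_algebra_def by (rule hull_minimal)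

lemma subset_closed_unital_algebra_generated: "S \<subseteq> closed_unital_algebra_generated S"
  unfolding closed_unital_algebra_generated_def by (rule hull_subset)

section \<open>Functional calculus and lattice operations in a closed unital algebra\<close>

context
  fixes A :: "('a::topological_space \<Rightarrow>\<^sub>C real) set"
  assumes A: "closed_unital_algebra A"
begin

text \<open>Membership is phrased for plain functions in the image of \<open>A\<close> under
  \<open>apply_bcontfun\<close>, so that pointwise formulas such as maxima and inverses can be
  handled without repacking them as bounded continuous functions.\<close>

lemma algebra_memI:
  assumes "f \<in> A" "\<And>x. \<phi> x = apply_bcontfun f x" shows "\<phi> \<in> apply_bcontfun ` A"
  using assms by (metis ext image_eqI)

lemma algebra_ops:
  shows "f \<in> A \<Longrightarrow> g \<in> A \<Longrightarrow> f + g \<in> A" "f \<in> A \<Longrightarrow> g \<in> A \<Longrightarrow> f - g \<in> A"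
    "f \<in> A \<Longrightarrow> g \<in> A \<Longrightarrow> times_bcontfun f g \<in> A" "f \<in> A \<Longrightarrow> c *\<^sub>R f \<in> A"
  using A unfolding closed_unital_algebra_def unital_subalgebra_def
  by (auto intro: subspace_add subspace_diff subspace_scale)

lemma algebra_add:
  assumes "\<phi> \<in> apply_bcontfun ` A" "\<psi> \<in> apply_bcontfun ` A"
  shows "(\<lambda>x. \<phi> x + \<psi> x) \<in> apply_bcontfun ` A"
proof -
  obtain f g where "f \<in> A" "g \<in> A" "\<phi> = apply_bcontfun f" "\<psi> = apply_bcontfun g"
    using assms by blast
  then show ?thesis
    by (intro algebra_memI[of "f + g"]) (simp_all add: algebra_ops)
qed

lemma algebra_cmult:
  "\<phi> \<in> apply_bcontfun ` A \<Longrightarrow> (\<lambda>x. c * \<phi> x) \<in> apply_bcontfun ` A"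
  using algebra_ops(4) by (auto intro!: algebra_memI[of "c *\<^sub>R _"])

lemma algebra_mult:
  assumes "\<phi> \<in> apply_bcontfun ` A" "\<psi> \<in> apply_bcontfun ` A"
  shows "(\<lambda>x. \<phi> x * \<psi> x) \<in> apply_bcontfun ` A"
proof -
  obtain f g where "f \<in> A" "g \<in> A" "\<phi> = apply_bcontfun f" "\<psi> = apply_bcontfun g"
    using assms by blast
  then show ?thesis
    by (intro algebra_memI[of "times_bcontfun f g"]) (simp_all add: algebra_ops)
qed

lemma algebra_const: "(\<lambda>x. c) \<in> apply_bcontfun ` A"
proof -
  have "const_bcontfun 1 \<in> A"
    using A unfolding closed_unital_algebra_def unital_subalgebra_def by blast
  then have "(\<lambda>x. 1) \<in> apply_bcontfun ` A"
    by (rule algebra_memI) (simp add: const_bcontfun.rep_eq)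
  from algebra_cmult[OF this, of c] show ?thesis by simp
qed

lemma algebra_diff:
  "\<phi> \<in> apply_bcontfun ` A \<Longrightarrow> \<psi> \<in> apply_bcontfun ` A \<Longrightarrow> (\<lambda>x. \<phi> x - \<psi> x) \<in> apply_bcontfun ` A"
  using algebra_add[of \<phi> "\<lambda>x. -1 * \<psi> x"] algebra_cmult[of \<psi> "-1"] by simp

lemma algebra_uniform_limit:
  assumes "\<phi> \<in> bcontfun"
    and approx: "\<And>e. 0 < e \<Longrightarrow> \<exists>\<psi>\<in>apply_bcontfun ` A. \<forall>x. \<bar>\<psi> x - \<phi> x\<bar> \<le> e"
  shows "\<phi> \<in> apply_bcontfun ` A"
proof -
  have \<phi>: "apply_bcontfun (Bcontfun \<phi>) = \<phi>" using assms(1) by (simp add: Bcontfun_inverse)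
  have "\<exists>g\<in>A. dist g (Bcontfun \<phi>) < e" if e: "0 < e" for e
  proof -
    obtain g where g: "g \<in> A" "\<And>x. \<bar>g x - \<phi> x\<bar> \<le> e / 2"
      using approx[of "e / 2"] e by (auto simp del: divide_le_eq_numeral1 le_divide_eq_numeral1)
    then have "dist g (Bcontfun \<phi>) \<le> e / 2"
      by (intro dist_bound) (simp add: \<phi> dist_real_def)
    then show ?thesis using g(1) e by force
  qed
  then have "Bcontfun \<phi> \<in> A"
    using A closed_approachable unfolding closed_unital_algebra_def by blast
  then show ?thesis using \<phi> by (metis image_eqI)
qed

text \<open>By Weierstrass, \<open>p\<close> is a uniform limit of polynomials on \<open>S\<close>;
  a polynomial in \<open>\<phi>\<close> stays in the algebra, and the algebra is closed.\<close>

lemma algebra_compose: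
  fixes p :: "real \<Rightarrow> real"
  assumes \<phi>: "\<phi> \<in> apply_bcontfun ` A" and S: "compact S" "continuous_on S p" "\<And>x. \<phi> x \<in> S"
  shows "(\<lambda>x. p (\<phi> x)) \<in> apply_bcontfun ` A"
proof (rule algebra_uniform_limit)
  have "bounded (p ` S)"
    using S by (intro compact_imp_bounded compact_continuous_image)
  then obtain b where b: "\<And>t. t \<in> S \<Longrightarrow> norm (p t) \<le> b"
    by (auto simp: bounded_iff)
  have "continuous_on UNIV \<phi>" using \<phi> by auto
  then show "(\<lambda>x. p (\<phi> x)) \<in> bcontfun"
    using S b by (intro bcontfun_normI[of _ b] continuous_on_compose2[OF S(2)]) auto
  fix e :: real assume "0 < e"
  then obtain q where q: "real_polynomial_function q" "\<And>t. t \<in> S \<Longrightarrow> \<bar>p t - q t\<bar> < e"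
    using Stone_Weierstrass_real_polynomial_function[OF S(1,2)] by blast
  from q(1) have "(\<lambda>x. q (\<phi> x)) \<in> apply_bcontfun ` A"
  proof (induction q)
    case (linear f)
    then obtain c where "f = (\<lambda>t. t * c)"
      using real_bounded_linear by blast
    then show ?case
      using algebra_cmult[OF \<phi>, of c] by (simp add: mult.commute)
  qed (auto intro: algebra_const algebra_add algebra_mult)
  then show "\<exists>\<psi>\<in>apply_bcontfun ` A. \<forall>x. \<bar>\<psi> x - p (\<phi> x)\<bar> \<le> e"
    using q(2) S(3) by (intro bexI[of _ "\<lambda>x. q (\<phi> x)"]) (auto simp: abs_minus_commute less_imp_le)
qed

lemma algebra_bounded:
  assumes "\<phi> \<in> apply_bcontfun ` A"
  obtains b where "\<And>x. \<bar>\<phi> x\<bar> \<le> b"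
  using assms norm_bounded by (metis imageE real_norm_def)

lemma algebra_abs:
  assumes "\<phi> \<in> apply_bcontfun ` A" shows "(\<lambda>x. \<bar>\<phi> x\<bar>) \<in> apply_bcontfun ` A"
proof -
  obtain b where "\<And>x. \<bar>\<phi> x\<bar> \<le> b" using algebra_bounded[OF assms] by blast
  then show ?thesis
    by (intro algebra_compose[OF assms, of "{-b..b}"] continuous_intros) (auto simp: abs_le_iff minus_le_iff)
qed

lemma algebra_inverse:
  assumes "\<phi> \<in> apply_bcontfun ` A" "0 < e" "\<And>x. e \<le> \<phi> x"
  shows "(\<lambda>x. inverse (\<phi> x)) \<in> apply_bcontfun ` A"
proof -
  obtain b where "\<And>x. \<bar>\<phi> x\<bar> \<le> b" using algebra_bounded[OF assms(1)] by blast
  then show ?thesis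
    using assms(2,3)
    by (intro algebra_compose[OF assms(1), of "{e..b}"] continuous_intros) (auto simp: abs_le_iff)
qed

lemma algebra_max:
  assumes "\<phi> \<in> apply_bcontfun ` A" "\<psi> \<in> apply_bcontfun ` A"
  shows "(\<lambda>x. max (\<phi> x) (\<psi> x)) \<in> apply_bcontfun ` A"
proof -
  have "(\<lambda>x. (1/2) * ((\<phi> x + \<psi> x) + \<bar>\<phi> x - \<psi> x\<bar>)) \<in> apply_bcontfun ` A"
    by (intro algebra_cmult algebra_add algebra_abs algebra_diff assms)
  moreover have "(\<lambda>x. max (\<phi> x) (\<psi> x)) = (\<lambda>x. (1/2) * ((\<phi> x + \<psi> x) + \<bar>\<phi> x - \<psi> x\<bar>))"
    by (auto simp: max_def abs_if fun_eq_iff)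
  ultimately show ?thesis by simp
qed

lemma algebra_Max:
  assumes "finite I" "I \<noteq> {}" "\<And>i. i \<in> I \<Longrightarrow> \<phi> i \<in> apply_bcontfun ` A"
  shows "(\<lambda>x. Max ((\<lambda>i. \<phi> i x) ` I)) \<in> apply_bcontfun ` A"
  using assms
proof (induction I rule: finite_ne_induct)
  case (insert i I)
  then show ?case by (simp add: algebra_max)
qed simp

end

text \<open>Total boundedness of the pseudometric given by \<open>P\<close>: each \<open>p\<close>
  has values between \<open>- norm p\<close> and \<open>norm p\<close>, which meets finitely many
  cells of length \<open>\<eta>\<close>. One representative for each occurring combination of cells
  forms the net.\<close>

lemma bcontfun_finite_net:
  fixes P :: "('a::topological_space \<Rightarrow>\<^sub>C real) set"
  assumes "finite P" "0 < \<eta>"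
  shows "\<exists>N. finite N \<and> N \<noteq> {} \<and> (\<forall>x. \<exists>k\<in>N. \<forall>p\<in>P. \<bar>p x - p k\<bar> \<le> \<eta>)"
proof -
  define c where "c x = (\<lambda>p\<in>P. \<lfloor>apply_bcontfun p x / \<eta>\<rfloor>)" for x
  have "range c \<subseteq> (\<Pi>\<^sub>E p\<in>P. {\<lfloor>- norm p / \<eta>\<rfloor>..\<lfloor>norm p / \<eta>\<rfloor>})"
  proof -
    have "\<lfloor>- norm p / \<eta>\<rfloor> \<le> \<lfloor>p x / \<eta>\<rfloor> \<and> \<lfloor>p x / \<eta>\<rfloor> \<le> \<lfloor>norm p / \<eta>\<rfloor>" for p :: "'a \<Rightarrow>\<^sub>C real" and x
      using norm_bounded[of p x] \<open>0 < \<eta>\<close>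
      by (intro conjI floor_mono divide_right_mono) (auto simp: abs_le_iff)
    then show ?thesis by (auto simp: c_def)
  qed
  then have "finite (range c)"
    by (rule finite_subset) (use assms in \<open>auto intro: finite_PiE\<close>)
  then obtain N where N: "finite N" "range c = c ` N"
    by (metis finite_subset_image order_refl)
  have "\<exists>k\<in>N. \<forall>p\<in>P. \<bar>p x - p k\<bar> \<le> \<eta>" for x
  proof -
    obtain k where k: "k \<in> N" "c x = c k" using N(2) by blast
    have "\<bar>p x - p k\<bar> \<le> \<eta>" if "p \<in> P" for p
    proof -
      have "\<lfloor>p x / \<eta>\<rfloor> = \<lfloor>p k / \<eta>\<rfloor>"
        using fun_cong[OF k(2), of p] that by (simp add: c_def)
      then have "\<bar>p x / \<eta> - p k / \<eta>\<bar> \<le> 1" by linarith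
      then show ?thesis
        using \<open>0 < \<eta>\<close> by (simp add: diff_divide_distrib[symmetric])
    qed
    then show ?thesis using k(1) by blast
  qed
  then show ?thesis using N(1) by blast
qed

text \<open>
  The approximant is a McShane-type formula: with \<open>\<rho>\<close> the pseudometric defined by \<open>P\<close>, it is
  the maximum of \<open>f k - (B / \<delta>) * \<rho> x k\<close> over a finite net of points \<open>k\<close>.
\<close>

lemma algebra_approximation:
  fixes f :: "'a::topological_space \<Rightarrow>\<^sub>C real"
  assumes A: "closed_unital_algebra A" and P: "finite P" "P \<subseteq> A" and "0 < \<delta>" "0 < e"
    and mod: "\<And>x y. (\<And>p. p \<in> P \<Longrightarrow> \<bar>apply_bcontfun p x - p y\<bar> \<le> \<delta>) \<Longrightarrow> \<bar>f x - f y\<bar> \<le> e"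
  shows "\<exists>h\<in>A. \<forall>x. \<bar>apply_bcontfun h x - f x\<bar> \<le> 2 * e"
proof -
  \<comment> \<open>\<open>2 * norm f\<close> bounds the oscillation of \<open>f\<close>; the
    summand 1 makes \<open>B\<close> positive, since it is divided by below.\<close>
  define B where "B = 2 * norm f + 1"
  have B: "0 < B" "\<And>x y. f x - f y \<le> B"
  proof -
    show "0 < B" using norm_ge_zero[of f] by (simp add: B_def del: norm_ge_zero)
    fix x y show "f x - f y \<le> B"
      using norm_bounded[of f x] norm_bounded[of f y] by (simp add: B_def abs_le_iff)
  qed
  \<comment> \<open>The zero function contributes the value 0 and keeps the set under
    \<open>Max\<close> nonempty when \<open>P\<close> is empty.\<close>
  define \<rho> where "\<rho> k x = Max ((\<lambda>p. \<bar>apply_bcontfun p x - p k\<bar>) ` insert 0 P)" for k x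
  \<comment> \<open>The first bound lets \<open>mod\<close> apply between a point and its net point;
    the second keeps the penalty at that net point below \<open>e\<close>.\<close>
  define \<eta> where "\<eta> = min \<delta> (e * \<delta> / B)"
  have \<eta>: "0 < \<eta>" "\<eta> \<le> \<delta>" "B / \<delta> * \<eta> \<le> e"
  proof -
    have "B / \<delta> * \<eta> \<le> B / \<delta> * (e * \<delta> / B)"
      using \<open>0 < \<delta>\<close> B(1) by (intro mult_left_mono) (auto simp: \<eta>_def)
    then show "B / \<delta> * \<eta> \<le> e" using \<open>0 < \<delta>\<close> B(1) by simp
  qed (use \<open>0 < \<delta>\<close> \<open>0 < e\<close> B(1) in \<open>auto simp: \<eta>_def\<close>)
  have \<rho>_le: "\<rho> k x \<le> c \<longleftrightarrow> 0 \<le> c \<and> (\<forall>p\<in>P. \<bar>p x - p k\<bar> \<le> c)" for k x c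
    unfolding \<rho>_def using P(1) by (subst Max_le_iff) auto
  have \<rho>_nonneg: "0 \<le> \<rho> k x" for k x
    using \<rho>_le[of k x "\<rho> k x"] by simp
  obtain N where N: "finite N" "N \<noteq> {}" "\<And>x. \<exists>k\<in>N. \<forall>p\<in>P. \<bar>p x - p k\<bar> \<le> \<eta>"
    using bcontfun_finite_net[OF P(1) \<eta>(1)] by blast
  let ?g = "\<lambda>k x. f k - B / \<delta> * \<rho> k x"
  let ?h = "\<lambda>x. Max ((\<lambda>k. ?g k x) ` N)"
  have "0 \<in> A" using A unfolding closed_unital_algebra_def unital_subalgebra_def
    by (blast intro: subspace_0)
  then have "\<rho> k \<in> apply_bcontfun ` A" for k
    unfolding \<rho>_def using P
    by (intro algebra_Max algebra_abs algebra_diff algebra_const A) auto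
  then have "?h \<in> apply_bcontfun ` A"
    using N by (intro algebra_Max algebra_diff algebra_const algebra_cmult A) auto
  then obtain h where h: "h \<in> A" "apply_bcontfun h = ?h" by fastforce
  have "\<bar>?h x - f x\<bar> \<le> 2 * e" for x
  proof -
    \<comment> \<open>Near net points are controlled by the modulus. For a far one the penalty
      exceeds \<open>B\<close>, the whole oscillation of \<open>f\<close>.\<close>
    have "?g k x \<le> f x + e" for k
    proof (cases "\<rho> k x \<le> \<delta>")
      case True
      then have "\<bar>f x - f k\<bar> \<le> e" by (intro mod) (auto simp: \<rho>_le)
      moreover have "0 \<le> B / \<delta> * \<rho> k x" using B(1) \<open>0 < \<delta>\<close> \<rho>_nonneg by simp
      ultimately show ?thesis by linarith
    next
      case False
      then have "B / \<delta> * \<delta> \<le> B / \<delta> * \<rho> k x"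
        using B(1) \<open>0 < \<delta>\<close> by (intro mult_left_mono) auto
      then show ?thesis using B(2)[of k x] \<open>0 < \<delta>\<close> \<open>0 < e\<close> by simp
    qed
    then have "?h x \<le> f x + e"
      using N(1,2) by (subst Max_le_iff) auto
    moreover have "f x - 2 * e \<le> ?h x"
    proof -
      obtain k where k: "k \<in> N" "\<And>p. p \<in> P \<Longrightarrow> \<bar>p x - p k\<bar> \<le> \<eta>" using N(3) by blast
      then have "\<rho> k x \<le> \<eta>" using \<eta>(1) by (simp add: \<rho>_le)
      then have "B / \<delta> * \<rho> k x \<le> B / \<delta> * \<eta>"
        using B(1) \<open>0 < \<delta>\<close> by (intro mult_left_mono) auto
      moreover have "\<bar>f x - f k\<bar> \<le> e" using k \<eta>(2) by (intro mod) (meson order_trans)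
      ultimately have "f x - 2 * e \<le> ?g k x" using \<eta>(3) by linarith
      also have "\<dots> \<le> ?h x" using N(1) k(1) by (intro Max_ge) auto
      finally show ?thesis .
    qed
    ultimately show ?thesis using \<open>0 < e\<close> by (simp add: abs_le_iff)
  qed
  then show ?thesis using h by (intro bexI[of _ h]) auto
qed

section \<open>Character spaces\<close>

lemma continuous_map_euclidean_metric:
  fixes f :: "'a \<Rightarrow> 'b::metric_space"
  shows "continuous_map X euclidean f \<longleftrightarrow>
    (\<forall>x\<in>topspace X. \<forall>e>0. \<exists>U. openin X U \<and> x \<in> U \<and> (\<forall>y\<in>U. dist (f x) (f y) < e))"
  using Met_TC.continuous_map_to_metric[of X f] by simp

text \<open>Used for both pointwise topologies: on characters the coordinates are the functions in
  \<open>A\<close>, on isometries they are the points of the space, with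
  \<open>I = UNIV\<close>.\<close>

lemma product_topology_metric_nhd:
  fixes \<xi> :: "'i \<Rightarrow> 'b::metric_space"
  assumes W: "openin (product_topology (\<lambda>_. euclidean) I) W" "\<xi> \<in> W"
  shows "\<exists>P e. finite P \<and> P \<subseteq> I \<and> 0 < e \<and>
    (\<forall>\<eta>\<in>extensional I. (\<forall>i\<in>P. dist (\<eta> i) (\<xi> i) < e) \<longrightarrow> \<eta> \<in> W)"
proof -
  obtain U where U: "finite {i \<in> I. U i \<noteq> (UNIV::'b set)}" "\<And>i. i \<in> I \<Longrightarrow> open (U i)"
      "\<xi> \<in> Pi\<^sub>E I U" "Pi\<^sub>E I U \<subseteq> W"
    using W unfolding openin_product_topology_alt by auto
  define P where "P = {i \<in> I. U i \<noteq> UNIV}"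
  have P: "finite P" "P \<subseteq> I" using U(1) by (auto simp: P_def)
  have "\<exists>e>0. \<forall>y. dist y (\<xi> i) < e \<longrightarrow> y \<in> U i" if "i \<in> P" for i
    using U(2,3) that P(2) by (auto simp: open_dist PiE_iff)
  then obtain r where r: "\<And>i. i \<in> P \<Longrightarrow> 0 < r i" "\<And>i y. i \<in> P \<Longrightarrow> dist y (\<xi> i) < r i \<Longrightarrow> y \<in> U i"
    by metis
  define e where "e = Min (insert 1 (r ` P))"
  have e: "0 < e" "\<And>i. i \<in> P \<Longrightarrow> e \<le> r i"
    using P(1) r(1) by (auto simp: e_def)
  have "\<eta> \<in> W" if "\<eta> \<in> extensional I" "\<forall>i\<in>P. dist (\<eta> i) (\<xi> i) < e" for \<eta>
  proof -
    have "\<eta> i \<in> U i" if "i \<in> I" for i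
    proof (cases "i \<in> P")
      case True
      then show ?thesis
        using r(2)[OF True] e(2)[OF True] \<open>\<forall>i\<in>P. dist (\<eta> i) (\<xi> i) < e\<close> by fastforce
    next
      case False
      then show ?thesis using that by (simp add: P_def)
    qed
    then show ?thesis
      using \<open>\<eta> \<in> extensional I\<close> by (intro subsetD[OF U(4)]) (auto simp: PiE_iff)
  qed
  then show ?thesis using P e(1) by blast
qed

section \<open>Characters of a closed unital algebra\<close>

context
  fixes A :: "('a::topological_space \<Rightarrow>\<^sub>C real) set"
  assumes A: "closed_unital_algebra A"
begin

lemma const_bcontfun_mem: "const_bcontfun c \<in> A"
proof -
  obtain f where "f \<in> A" "apply_bcontfun f = (\<lambda>x. c)"
    using algebra_const[OF A, of c] by (auto simp: image_iff)
  moreover from this have "f = const_bcontfun c"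
    by (intro bcontfun_eqI) (simp add: const_bcontfun.rep_eq)
  ultimately show ?thesis by simp
qed

lemma character_add: "\<xi> \<in> characters A \<Longrightarrow> f \<in> A \<Longrightarrow> g \<in> A \<Longrightarrow> \<xi> (f + g) = \<xi> f + \<xi> g"
  and character_times: "\<xi> \<in> characters A \<Longrightarrow> f \<in> A \<Longrightarrow> g \<in> A \<Longrightarrow> \<xi> (times_bcontfun f g) = \<xi> f * \<xi> g"
  and character_scale: "\<xi> \<in> characters A \<Longrightarrow> f \<in> A \<Longrightarrow> \<xi> (c *\<^sub>R f) = c * \<xi> f"
  by (simp_all add: characters_def)

lemma character_const: "\<xi> \<in> characters A \<Longrightarrow> \<xi> (const_bcontfun c) = c"
proof -
  assume "\<xi> \<in> characters A"
  moreover have "const_bcontfun c = c *\<^sub>R (const_bcontfun 1 :: 'a \<Rightarrow>\<^sub>C real)"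
    by (intro bcontfun_eqI) (simp add: const_bcontfun.rep_eq)
  ultimately show ?thesis
    using character_scale[OF _ const_bcontfun_mem, of \<xi> c 1] by (simp add: characters_def)
qed

lemma character_diff:
  assumes "\<xi> \<in> characters A" "f \<in> A" "g \<in> A" shows "\<xi> (f - g) = \<xi> f - \<xi> g"
  using character_add[OF assms(1) algebra_ops(2)[OF A assms(2,3)] assms(3)] by simp

text \<open>A function bounded below by a positive constant is invertible in \<open>A\<close>, and a
  character cannot vanish at an invertible element.\<close>

lemma character_kernel_not_bounded_below:
  assumes \<xi>: "\<xi> \<in> characters A" and f: "f \<in> A" "\<xi> f = 0" and "0 < e"
  shows "\<exists>x. f x < e"
proof (rule ccontr)
  assume "\<nexists>x. f x < e"
  then have ge: "e \<le> f x" for x by (simp add: not_less)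
  have "(\<lambda>x. inverse (f x)) \<in> apply_bcontfun ` A"
    by (rule algebra_inverse[OF A _ \<open>0 < e\<close> ge]) (use f in simp)
  then obtain g where g: "g \<in> A" "apply_bcontfun g = (\<lambda>x. inverse (f x))"
    by (auto simp: image_iff)
  have "f x * inverse (f x) = 1" for x
    using ge[of x] \<open>0 < e\<close> by simp
  then have "times_bcontfun f g = const_bcontfun 1"
    by (intro bcontfun_eqI) (simp add: g const_bcontfun.rep_eq)
  then have "\<xi> f * \<xi> g = 1"
    using character_times[OF \<xi> f(1) g(1)] character_const[OF \<xi>] by metis
  then show False using f(2) by simp
qed

text \<open>The sum of the squares of \<open>p - \<xi> p\<close> over \<open>P\<close> is in the
  kernel of \<open>\<xi>\<close>, so it takes values below \<open>e\<^sup>2\<close>; at such a point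
  every single summand is small.\<close>

lemma character_approx_by_point:
  assumes \<xi>: "\<xi> \<in> characters A" and P: "finite P" "P \<subseteq> A" and "0 < e"
  shows "\<exists>x. \<forall>p\<in>P. \<bar>apply_bcontfun p x - \<xi> p\<bar> < e"
proof -
  have "\<exists>h\<in>A. \<xi> h = 0 \<and> (\<forall>x. apply_bcontfun h x = (\<Sum>p\<in>P. (apply_bcontfun p x - \<xi> p)\<^sup>2))"
    using P
  proof (induction P)
    case empty
    then show ?case
      using const_bcontfun_mem[of 0] character_const[OF \<xi>, of 0] by (intro bexI[of _ 0]) auto
  next
    case (insert p P)
    then obtain h where h: "h \<in> A" "\<xi> h = 0" "\<And>x. apply_bcontfun h x = (\<Sum>p\<in>P. (apply_bcontfun p x - \<xi> p)\<^sup>2)"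
      by auto
    define q where "q = p - const_bcontfun (\<xi> p)"
    have p: "p \<in> A" using insert.prems by simp
    then have q: "q \<in> A" "\<xi> q = 0"
      using algebra_ops(2)[OF A p const_bcontfun_mem] character_diff[OF \<xi> p const_bcontfun_mem]
        character_const[OF \<xi>] by (auto simp: q_def)
    have "times_bcontfun q q + h \<in> A"
      by (intro algebra_ops[OF A] q h)
    moreover have "\<xi> (times_bcontfun q q + h) = 0"
      using character_add[OF \<xi> algebra_ops(3)[OF A q(1) q(1)] h(1)] character_times[OF \<xi> q(1) q(1)]
        q(2) h(2) by simp
    moreover have "apply_bcontfun (times_bcontfun q q + h) x = (\<Sum>p\<in>insert p P. (apply_bcontfun p x - \<xi> p)\<^sup>2)" for x
      using insert.hyps by (simp add: h(3) q_def const_bcontfun.rep_eq power2_eq_square)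
    ultimately show ?case by blast
  qed
  then obtain h where h: "h \<in> A" "\<xi> h = 0" "\<And>x. apply_bcontfun h x = (\<Sum>p\<in>P. (apply_bcontfun p x - \<xi> p)\<^sup>2)"
    by blast
  obtain x where x: "h x < e\<^sup>2"
    using character_kernel_not_bounded_below[OF \<xi> h(1,2), of "e\<^sup>2"] \<open>0 < e\<close> by auto
  have "\<bar>apply_bcontfun p x - \<xi> p\<bar> < e" if "p \<in> P" for p
  proof -
    have "(p x - \<xi> p)\<^sup>2 \<le> h x"
      unfolding h(3) using member_le_sum[OF that, of "\<lambda>p. (apply_bcontfun p x - \<xi> p)\<^sup>2"] P(1) by simp
    then have "\<bar>p x - \<xi> p\<bar>\<^sup>2 < e\<^sup>2" using x by simp
    then show ?thesis using \<open>0 < e\<close> power2_less_imp_less by (metis less_imp_le)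
  qed
  then show ?thesis by blast
qed

text \<open>Automatic continuity: the value of a character at \<open>f\<close> is a limit of values
  of \<open>f\<close>.\<close>

lemma character_abs_le_norm:
  assumes \<xi>: "\<xi> \<in> characters A" and f: "f \<in> A"
  shows "\<bar>\<xi> f\<bar> \<le> norm f"
proof (rule field_le_epsilon)
  fix e :: real assume "0 < e"
  then obtain x where "\<bar>f x - \<xi> f\<bar> < e"
    using character_approx_by_point[OF \<xi>, of "{f}"] f by auto
  then show "\<bar>\<xi> f\<bar> \<le> norm f + e"
    using norm_bounded[of f x] by simp
qed

lemma evaluation_in_characters: "evaluation A x \<in> characters A"
  using const_bcontfun_mem algebra_ops[OF A]
  by (auto simp: characters_def evaluation_def const_bcontfun.rep_eq)

lemma topspace_character_topology: "topspace (character_topology A) = characters A"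
  by (auto simp: character_topology_def characters_def PiE_def)

lemma continuous_map_into_character_topology:
  "continuous_map X (character_topology A) F \<longleftrightarrow>
    (\<forall>x\<in>topspace X. F x \<in> characters A) \<and> (\<forall>f\<in>A. continuous_map X euclideanreal (\<lambda>x. F x f))"
proof -
  have "\<forall>x\<in>topspace X. F x \<in> extensional A" if "\<forall>x\<in>topspace X. F x \<in> characters A"
    using that by (auto simp: characters_def)
  then show ?thesis
    unfolding character_topology_def continuous_map_in_subtopology continuous_map_componentwise
    by auto
qed

lemma continuous_map_character_apply:
  "f \<in> A \<Longrightarrow> continuous_map (character_topology A) euclideanreal (\<lambda>\<xi>. \<xi> f)"
  using continuous_map_into_character_topology[of "character_topology A" id] by simp

lemma Hausdorff_space_character_topology: "Hausdorff_space (character_topology A)"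
  by (simp add: character_topology_def Hausdorff_space_subtopology Hausdorff_space_product_topology)

lemma completely_regular_space_character_topology: "completely_regular_space (character_topology A)"
  by (simp add: character_topology_def completely_regular_space_subtopology
      completely_regular_space_product_topology metrizable_imp_completely_regular_space
      metrizable_space_euclidean)

text \<open>As in the Banach-Alaoglu theorem: the norm bound places the characters in a product of
  compact intervals, compact by Tychonoff, and they form a closed subset of the full
  product.\<close>

lemma compact_space_character_topology: "compact_space (character_topology A)"
proof -
  let ?X = "product_topology (\<lambda>_. euclideanreal) A"
  have sub: "characters A \<subseteq> topspace ?X"
    by (auto simp: characters_def PiE_def)
  have one: "const_bcontfun 1 \<in> A" by (rule const_bcontfun_mem)
  have "?X closure_of characters A \<subseteq> characters A"
  proof
    fix \<xi> assume \<xi>: "\<xi> \<in> ?X closure_of characters A"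
    \<comment> \<open>Apart from extensionality, each defining condition of a character equates two
      continuous functions of the coordinates, and hence passes to the closure.\<close>
    have eq: "F \<xi> = H \<xi>"
      if "continuous_map ?X euclideanreal F" "continuous_map ?X euclideanreal H"
        "\<And>\<eta>. \<eta> \<in> characters A \<Longrightarrow> F \<eta> = H \<eta>" for F H
      using forall_in_closure_of_eq[OF \<xi> Hausdorff_space_euclidean that] .
    have proj: "continuous_map ?X euclideanreal (\<lambda>\<eta>. \<eta> f)" if "f \<in> A" for f
      using that by (rule continuous_map_product_projection)
    have "\<xi> \<in> extensional A"
      using \<xi> in_closure_of[of \<xi> ?X] by (auto simp: PiE_def)
    moreover have "\<xi> (const_bcontfun 1) = 1"
      by (rule eq) (auto intro: proj one simp: character_const)
    moreover have "\<xi> (c *\<^sub>R f) = c * \<xi> f" if "f \<in> A" for c f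
      by (rule eq) (use that in \<open>auto intro!: proj algebra_ops[OF A] continuous_intros simp: character_scale\<close>)
    moreover have "\<xi> (f + g) = \<xi> f + \<xi> g" if "f \<in> A" "g \<in> A" for f g
      by (rule eq) (use that in \<open>auto intro!: proj algebra_ops[OF A] continuous_intros simp: character_add\<close>)
    moreover have "\<xi> (times_bcontfun f g) = \<xi> f * \<xi> g" if "f \<in> A" "g \<in> A" for f g
      by (rule eq) (use that in \<open>auto intro!: proj algebra_ops[OF A] continuous_intros simp: character_times\<close>)
    ultimately show "\<xi> \<in> characters A"
      by (simp add: characters_def)
  qed
  then have "closedin ?X (characters A)"
    using sub closure_of_subset_eq by blast
  moreover have "characters A \<subseteq> (\<Pi>\<^sub>E f\<in>A. cball 0 (norm f))"
    using character_abs_le_norm by (auto simp: PiE_def characters_def)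
  moreover have "compactin ?X (\<Pi>\<^sub>E f\<in>A. cball 0 (norm f))"
    by (simp add: compactin_PiE)
  ultimately have "compactin ?X (characters A)"
    using closed_compactin by blast
  then show ?thesis
    by (simp add: character_topology_def compact_space_subtopology)
qed

lemma evaluation_dense: "character_topology A closure_of range (evaluation A) = characters A"
proof -
  have "\<exists>x. evaluation A x \<in> T" if "\<xi> \<in> T" and T: "openin (character_topology A) T" for \<xi> T
  proof -
    obtain W where W: "openin (product_topology (\<lambda>_. euclideanreal) A) W" "T = W \<inter> characters A"
      using T by (auto simp: character_topology_def openin_subtopology)
    then obtain P e where P: "finite P" "P \<subseteq> A" "0 < e"
      "\<forall>\<eta>\<in>extensional A. (\<forall>f\<in>P. dist (\<eta> f) (\<xi> f) < e) \<longrightarrow> \<eta> \<in> W"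
      using product_topology_metric_nhd[OF W(1), of \<xi>] \<open>\<xi> \<in> T\<close> by auto
    have "\<xi> \<in> characters A" using \<open>\<xi> \<in> T\<close> W(2) by simp
    from character_approx_by_point[OF this P(1-3)]
    obtain x where x: "\<forall>f\<in>P. \<bar>apply_bcontfun f x - \<xi> f\<bar> < e" ..
    have "evaluation A x \<in> W"
      using x P(2) by (intro P(4)[rule_format]) (auto simp: evaluation_def dist_real_def)
    then show ?thesis
      using W(2) evaluation_in_characters by blast
  qed
  then show ?thesis
    using closure_of_subset_topspace[of "character_topology A"]
    by (auto simp: topspace_character_topology in_closure_of)
qed

lemma continuous_map_evaluation: "continuous_map euclidean (character_topology A) (evaluation A)"
  unfolding continuous_map_into_character_topology
  by (simp add: evaluation_in_characters) (simp add: evaluation_def)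

text \<open>By \<open>pull\<close>, a character of \<open>A\<close> induces one on the continuous
  functions of \<open>K\<close>, namely \<open>h\<close> to \<open>\<xi> (c h)\<close>. Compactness
  of \<open>K\<close> makes this evaluation at a point, and that point is the image of
  \<open>\<xi>\<close> under the factor map.\<close>

lemma compactification_factor_of_character_topology:
  fixes K :: "'k topology" and \<nu> :: "'a \<Rightarrow> 'k"
  assumes K: "compact_space K" "Hausdorff_space K" "completely_regular_space K"
    and \<nu>: "\<And>x. \<nu> x \<in> topspace K"
    and pull: "\<And>h. continuous_map K euclideanreal h \<Longrightarrow> (\<lambda>x. h (\<nu> x)) \<in> apply_bcontfun ` A"
  shows "compactification_factor euclidean K \<nu> (character_topology A) (evaluation A)"
proof -
  define c where "c h = Bcontfun (\<lambda>x. h (\<nu> x))" for h :: "'k \<Rightarrow> real"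
  have c: "c h \<in> A" "apply_bcontfun (c h) = (\<lambda>x. h (\<nu> x))" if h: "continuous_map K euclideanreal h" for h
  proof -
    obtain f where f: "f \<in> A" "(\<lambda>x. h (\<nu> x)) = apply_bcontfun f"
      using pull[OF h] by auto
    then have "c h = f" by (simp add: c_def apply_bcontfun_inverse)
    then show "c h \<in> A" "apply_bcontfun (c h) = (\<lambda>x. h (\<nu> x))" using f by simp_all
  qed
  have "\<exists>p\<in>topspace K. \<forall>h. continuous_map K euclideanreal h \<longrightarrow> h p = \<xi> (c h)"
    if \<xi>: "\<xi> \<in> characters A" for \<xi>
  proof -
    \<comment> \<open>The point sought lies in all these closed sets. Finitely many of them share
      some \<open>\<nu> x\<close>, by approximation of \<open>\<xi>\<close> at points of the
      original space.\<close>
    define C where "C = (\<lambda>(h, e). {p \<in> topspace K. \<bar>h p - \<xi> (c h)\<bar> \<le> e})"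
    let ?I = "{h. continuous_map K euclideanreal h} \<times> {0::real<..}"
    have "\<Inter> (C ` ?I) \<noteq> {}"
    proof (rule compact_space_fip[THEN iffD1, OF K(1), rule_format], intro conjI ballI allI impI)
      fix S assume "S \<in> C ` ?I"
      then obtain h e where h: "continuous_map K euclideanreal h" and S: "S = C (h, e)" by auto
      have "continuous_map K euclideanreal (\<lambda>p. \<bar>h p - \<xi> (c h)\<bar>)"
        by (intro continuous_intros h)
      from closedin_continuous_map_preimage[OF this, of "{..e}"]
      show "closedin K S" by (simp add: S C_def)
    next
      fix F assume "finite F \<and> F \<subseteq> C ` ?I"
      then obtain J where J: "finite J" "J \<subseteq> ?I" "F = C ` J"
        by (meson finite_subset_image)
      define e where "e = Min (insert 1 (snd ` J))"
      have e: "0 < e" using J(1,2) by (auto simp: e_def)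
      have e_le: "e \<le> r" if "(h, r) \<in> J" for h r
        unfolding e_def by (rule Min_le) (use J(1) that in force)+
      have "finite (c ` fst ` J)" "c ` fst ` J \<subseteq> A"
        using J(1,2) c(1) by auto
      from character_approx_by_point[OF \<xi> this e]
      obtain x where x: "\<forall>p\<in>c ` fst ` J. \<bar>apply_bcontfun p x - \<xi> p\<bar> < e" ..
      have "\<nu> x \<in> C (h, r)" if hr: "(h, r) \<in> J" for h r
      proof -
        have h: "continuous_map K euclideanreal h" using hr J(2) by auto
        have "c h \<in> c ` fst ` J" using hr by force
        then have "\<bar>h (\<nu> x) - \<xi> (c h)\<bar> < e" using bspec[OF x, of "c h"] c(2)[OF h] by simp
        then show ?thesis using e_le[OF hr] \<nu> by (simp add: C_def)
      qed
      then have "\<nu> x \<in> \<Inter> F" using J(3) by auto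
      then show "\<Inter> F \<noteq> {}" by blast
    qed
    then obtain p where p: "\<And>h e. continuous_map K euclideanreal h \<Longrightarrow> 0 < e \<Longrightarrow> p \<in> C (h, e)"
      by auto
    have "p \<in> topspace K"
      using p[of "\<lambda>_. 0" 1] by (simp add: C_def)
    moreover have "h p = \<xi> (c h)" if h: "continuous_map K euclideanreal h" for h
    proof -
      have "\<bar>h p - \<xi> (c h)\<bar> \<le> e" if "0 < e" for e
        using p[OF h that] by (simp add: C_def)
      then show ?thesis
        using dense_ge[of 0 "\<bar>h p - \<xi> (c h)\<bar>"] by simp
    qed
    ultimately show ?thesis by blast
  qed
  then obtain \<pi> where \<pi>: "\<And>\<xi>. \<xi> \<in> characters A \<Longrightarrow> \<pi> \<xi> \<in> topspace K"
      "\<And>\<xi> h. \<xi> \<in> characters A \<Longrightarrow> continuous_map K euclideanreal h \<Longrightarrow> h (\<pi> \<xi>) = \<xi> (c h)"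
    by metis
  have "continuous_map (character_topology A) K \<pi>"
    unfolding continuous_map_eq_topcontinuous_at topcontinuous_at_def
  proof (intro ballI conjI allI impI)
    fix \<xi> V assume "\<xi> \<in> topspace (character_topology A)"
    then have \<xi>: "\<xi> \<in> characters A" by (simp add: topspace_character_topology)
    assume "openin K V \<and> \<pi> \<xi> \<in> V"
    \<comment> \<open>Complete regularity replaces the neighbourhood \<open>V\<close> by one test
      function, whose value at \<open>\<pi> \<eta>\<close> is the coordinate
      \<open>\<eta> (c h)\<close> and so depends continuously on \<open>\<eta>\<close>.\<close>
    then obtain h where h: "continuous_map K euclideanreal h" "h (\<pi> \<xi>) = 0" "h ` (topspace K - V) \<subseteq> {1}"
      using K(3) unfolding completely_regular_space_alt' by meson
    let ?U = "{\<eta> \<in> topspace (character_topology A). \<eta> (c h) \<in> {..<1}}"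
    have "openin (character_topology A) ?U"
      by (rule openin_continuous_map_preimage[OF continuous_map_character_apply[OF c(1)[OF h(1)]]]) simp
    moreover have "\<xi> \<in> ?U"
      using \<xi> h(2) \<pi>(2)[OF \<xi> h(1)] by (simp add: topspace_character_topology)
    moreover have "\<pi> \<eta> \<in> V" if "\<eta> \<in> ?U" for \<eta>
    proof (rule ccontr)
      assume "\<pi> \<eta> \<notin> V"
      have \<eta>: "\<eta> \<in> characters A" using that by (simp add: topspace_character_topology)
      then have "h (\<pi> \<eta>) = 1" using h(3) \<open>\<pi> \<eta> \<notin> V\<close> \<pi>(1) by blast
      then show False using that \<pi>(2)[OF \<eta> h(1)] by simp
    qed
    ultimately show "\<exists>U. openin (character_topology A) U \<and> \<xi> \<in> U \<and> (\<forall>\<eta>\<in>U. \<pi> \<eta> \<in> V)"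
      by blast
  qed (auto simp: topspace_character_topology \<pi>)
  moreover have "\<pi> (evaluation A x) = \<nu> x" for x
  proof (rule ccontr)
    assume ne: "\<pi> (evaluation A x) \<noteq> \<nu> x"
    have "closedin K {\<nu> x}"
      using K(2) \<nu> by (simp add: closedin_Hausdorff_sing_eq)
    then obtain h where h: "continuous_map K euclideanreal h" "h (\<pi> (evaluation A x)) = 0" "h ` {\<nu> x} \<subseteq> {1}"
      using K(3) ne \<pi>(1)[OF evaluation_in_characters] unfolding completely_regular_space_alt
      by (metis DiffI singletonD)
    have "h (\<pi> (evaluation A x)) = h (\<nu> x)"
      using \<pi>(2)[OF evaluation_in_characters h(1)] c[OF h(1)] by (simp add: evaluation_def)
    then show False using h by simp
  qed
  ultimately show ?thesis
    unfolding compactification_factor_def by auto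
qed

end

section \<open>The greatest equivariant compactification\<close>

text \<open>Boundedness of \<open>f\<close> makes the real supremum in \<open>RUC\<close> a genuine
  upper bound. Conversely, pointwise bounds by \<open>e / 2\<close> restore the strict inequality
  for the supremum.\<close>

lemma RUC_iff:
  fixes f :: "'x::topological_space \<Rightarrow>\<^sub>C real"
  shows
  "f \<in> RUC G T \<phi> \<longleftrightarrow>
    (\<forall>e>0. \<exists>V. openin T V \<and> \<one>\<^bsub>G\<^esub> \<in> V \<and> (\<forall>v\<in>V. \<forall>x. \<bar>f (\<phi> v x) - f x\<bar> \<le> e))"
proof
  assume f: "f \<in> RUC G T \<phi>"
  have bdd: "bdd_above (range (\<lambda>x. \<bar>f (\<phi> v x) - f x\<bar>))" for v
  proof (rule bdd_aboveI2)
    show "\<bar>f (\<phi> v x) - f x\<bar> \<le> norm f + norm f" for x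
      using norm_bounded[of f "\<phi> v x"] norm_bounded[of f x] by simp
  qed
  show "\<forall>e>0. \<exists>V. openin T V \<and> \<one>\<^bsub>G\<^esub> \<in> V \<and> (\<forall>v\<in>V. \<forall>x. \<bar>f (\<phi> v x) - f x\<bar> \<le> e)"
  proof (intro allI impI)
    fix e :: real assume "0 < e"
    then obtain V where V: "openin T V" "\<one>\<^bsub>G\<^esub> \<in> V" "\<forall>v\<in>V. (SUP x. \<bar>f (\<phi> v x) - f x\<bar>) < e"
      using f unfolding RUC_def by auto
    have "\<bar>f (\<phi> v x) - f x\<bar> \<le> e" if "v \<in> V" for v x
    proof -
      have "\<bar>f (\<phi> v x) - f x\<bar> \<le> (SUP x. \<bar>f (\<phi> v x) - f x\<bar>)"
        by (rule cSUP_upper[OF UNIV_I bdd])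
      then show ?thesis using V(3) that by fastforce
    qed
    then show "\<exists>V. openin T V \<and> \<one>\<^bsub>G\<^esub> \<in> V \<and> (\<forall>v\<in>V. \<forall>x. \<bar>f (\<phi> v x) - f x\<bar> \<le> e)"
      using V by blast
  qed
next
  assume R: "\<forall>e>0. \<exists>V. openin T V \<and> \<one>\<^bsub>G\<^esub> \<in> V \<and> (\<forall>v\<in>V. \<forall>x. \<bar>f (\<phi> v x) - f x\<bar> \<le> e)"
  have "\<exists>V. openin T V \<and> \<one>\<^bsub>G\<^esub> \<in> V \<and> (\<forall>v\<in>V. (SUP x. \<bar>f (\<phi> v x) - f x\<bar>) < e)" if "0 < e" for e
  proof -
    obtain V where V: "openin T V" "\<one>\<^bsub>G\<^esub> \<in> V" "\<forall>v\<in>V. \<forall>x. \<bar>f (\<phi> v x) - f x\<bar> \<le> e / 2"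
      using R[rule_format, of "e / 2"] \<open>0 < e\<close> by auto
    have "(SUP x. \<bar>f (\<phi> v x) - f x\<bar>) \<le> e / 2" if "v \<in> V" for v
      using V(3) that by (intro cSUP_least) auto
    then show ?thesis using V \<open>0 < e\<close> by (intro exI[of _ V]) fastforce
  qed
  then show "f \<in> RUC G T \<phi>"
    unfolding RUC_def by blast
qed

lemma RUC_D:
  fixes f :: "'x::topological_space \<Rightarrow>\<^sub>C real"
  assumes "f \<in> RUC G T \<phi>" "0 < e"
  obtains V where "openin T V" "\<one>\<^bsub>G\<^esub> \<in> V" "\<And>v x. v \<in> V \<Longrightarrow> \<bar>f (\<phi> v x) - f x\<bar> \<le> e"
proof -
  have "\<exists>V. openin T V \<and> \<one>\<^bsub>G\<^esub> \<in> V \<and> (\<forall>v\<in>V. \<forall>x. \<bar>f (\<phi> v x) - f x\<bar> \<le> e)"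
    using assms by (simp add: RUC_iff)
  then show ?thesis by (elim exE conjE) (rule that, auto)
qed

lemma RUC_I:
  fixes f :: "'x::topological_space \<Rightarrow>\<^sub>C real"
  assumes "\<And>e. 0 < e \<Longrightarrow> \<exists>V. openin T V \<and> \<one>\<^bsub>G\<^esub> \<in> V \<and> (\<forall>v\<in>V. \<forall>x. \<bar>f (\<phi> v x) - f x\<bar> \<le> e)"
  shows "f \<in> RUC G T \<phi>"
  using assms unfolding RUC_iff by blast

text \<open>Tube lemma: the pairs \<open>(g, p)\<close> at which \<open>g\<close> changes
  \<open>h p\<close> by less than \<open>e\<close> form an open set containing the identity times
  the compact \<open>K\<close>, hence a tube \<open>U \<times> K\<close> around it. Equivariance
  carries the uniform bound back along \<open>\<nu>\<close>.\<close>

lemma compactification_pullback_in_RUC: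
  fixes \<nu> :: "'x::topological_space \<Rightarrow> 'k"
  assumes K: "equivariant_compactification G T euclidean \<phi> K \<psi> \<nu>"
    and h: "continuous_map K euclideanreal h"
  shows "(\<lambda>x. h (\<nu> x)) \<in> apply_bcontfun ` RUC G T \<phi>"
proof -
  have cK: "compact_space K" and c\<nu>: "continuous_map euclidean K \<nu>"
    and cont: "continuous_map (prod_topology T K) K (\<lambda>(g, p). \<psi> g p)"
    and act: "group_action G (topspace K) \<psi>" and G: "topological_group G T"
    and eqv: "\<And>g x. g \<in> carrier G \<Longrightarrow> \<nu> (\<phi> g x) = \<psi> g (\<nu> x)"
    using K by (auto simp: equivariant_compactification_def G_space_def)
  have \<nu>: "\<nu> x \<in> topspace K" for x
    using c\<nu> by (auto simp: continuous_map_def)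
  have "compactin euclideanreal (h ` topspace K)"
    using image_compactin[OF _ h] cK by (simp add: compact_space_def)
  then have "bounded (h ` topspace K)"
    by (simp add: compact_imp_bounded)
  then obtain b where b: "\<And>p. p \<in> topspace K \<Longrightarrow> norm (h p) \<le> b"
    by (auto simp: bounded_iff)
  have "continuous_map euclidean euclideanreal (h \<circ> \<nu>)"
    by (rule continuous_map_compose[OF c\<nu> h])
  then have "(\<lambda>x. h (\<nu> x)) \<in> bcontfun"
    using b[OF \<nu>] by (intro bcontfun_normI[of _ b]) (auto simp: o_def)
  then obtain f where f: "(\<lambda>x. h (\<nu> x)) = apply_bcontfun f"
    by (metis Bcontfun_inverse)
  have oneG: "\<one>\<^bsub>G\<^esub> \<in> carrier G" and TG: "topspace T = carrier G"
    using G by (auto simp: topological_group_def group.is_monoid monoid.one_closed)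
  have one: "\<psi> \<one>\<^bsub>G\<^esub> p = p" if "p \<in> topspace K" for p
    using group_action.id_eq_one[OF act] that by (metis restrict_apply')
  have "f \<in> RUC G T \<phi>"
  proof (rule RUC_I)
    fix e :: real assume "0 < e"
    let ?d = "\<lambda>z. \<bar>h (\<psi> (fst z) (snd z)) - h (snd z)\<bar>"
    let ?W = "{z \<in> topspace (prod_topology T K). ?d z \<in> {..<e}}"
    have "continuous_map (prod_topology T K) euclideanreal (\<lambda>z. h (\<psi> (fst z) (snd z)))"
      using continuous_map_compose[OF cont h] by (simp add: o_def case_prod_unfold)
    moreover have "continuous_map (prod_topology T K) euclideanreal (\<lambda>z. h (snd z))"
      using continuous_map_compose[OF continuous_map_snd h] by (simp add: o_def)
    ultimately have "continuous_map (prod_topology T K) euclideanreal ?d"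
      by (intro continuous_intros)
    then have W: "openin (prod_topology T K) ?W"
      by (rule openin_continuous_map_preimage) simp
    have "{\<one>\<^bsub>G\<^esub>} \<times> topspace K \<subseteq> ?W"
      using oneG TG one \<open>0 < e\<close> by auto
    then obtain U V where U: "openin T U" "\<one>\<^bsub>G\<^esub> \<in> U" "topspace K \<subseteq> V" "U \<times> V \<subseteq> ?W"
      using tube_lemma_right[OF W cK[unfolded compact_space_def], of "\<one>\<^bsub>G\<^esub>"] oneG TG by auto
    have "\<bar>f (\<phi> v x) - f x\<bar> \<le> e" if "v \<in> U" for v x
    proof -
      have "v \<in> carrier G" using openin_subset[OF U(1)] TG that by blast
      moreover have "(v, \<nu> x) \<in> ?W" using U(3,4) \<nu> that by blast
      ultimately show ?thesis by (simp add: f[symmetric] eqv)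
    qed
    then show "\<exists>V. openin T V \<and> \<one>\<^bsub>G\<^esub> \<in> V \<and> (\<forall>v\<in>V. \<forall>x. \<bar>f (\<phi> v x) - f x\<bar> \<le> e)"
      using U by blast
  qed
  then show ?thesis using f by blast
qed

definition translate ::
  "('g \<Rightarrow> 'x \<Rightarrow> 'x) \<Rightarrow> 'g \<Rightarrow> ('x::topological_space \<Rightarrow>\<^sub>C real) \<Rightarrow> 'x \<Rightarrow>\<^sub>C real" where
  "translate \<phi> g f = Bcontfun (\<lambda>x. f (\<phi> g x))"

text \<open>Translation reverses products, and precomposing characters with it reverses them again,
  so this is a left action. Both restrictions are for extensionality: of characters as functions on
  \<open>A\<close>, and of the elements of \<open>Bij\<close> as maps on the character
  space.\<close>

definition character_action ::
  "('g \<Rightarrow> 'x \<Rightarrow> 'x) \<Rightarrow> ('x::topological_space \<Rightarrow>\<^sub>C real) set \<Rightarrow> 'g \<Rightarrow>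
    (('x \<Rightarrow>\<^sub>C real) \<Rightarrow> real) \<Rightarrow> ('x \<Rightarrow>\<^sub>C real) \<Rightarrow> real" where
  "character_action \<phi> A g = (\<lambda>\<xi>\<in>characters A. \<lambda>f\<in>A. \<xi> (translate \<phi> g f))"

context
  fixes G :: "('g, 'm) monoid_scheme" and T :: "'g topology" and \<phi> :: "'g \<Rightarrow> 'x \<Rightarrow> 'x::topological_space"
  assumes X: "G_space G T euclidean \<phi>"
begin

lemma G_space_group: "group G" and G_space_topspace: "topspace T = carrier G"
  using X by (auto simp: G_space_def topological_group_def)

lemma G_space_continuous: "g \<in> carrier G \<Longrightarrow> continuous_on UNIV (\<phi> g)"
proof -
  assume "g \<in> carrier G"
  then have "continuous_map euclidean (prod_topology T euclidean) (\<lambda>x. (g, x))"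
    by (intro continuous_map_pairedI) (auto simp: G_space_topspace)
  moreover have "continuous_map (prod_topology T euclidean) euclidean (\<lambda>(g, x). \<phi> g x)"
    using X by (simp add: G_space_def)
  ultimately have "continuous_map euclidean euclidean ((\<lambda>(g, x). \<phi> g x) \<circ> (\<lambda>x. (g, x)))"
    by (rule continuous_map_compose)
  then show ?thesis by (simp add: o_def)
qed

lemma G_space_mult: "g \<in> carrier G \<Longrightarrow> h \<in> carrier G \<Longrightarrow> \<phi> (g \<otimes>\<^bsub>G\<^esub> h) x = \<phi> g (\<phi> h x)"
  using group_action.composition_rule[of G UNIV \<phi> x g h] X by (simp add: G_space_def)

lemma G_space_one: "\<phi> \<one>\<^bsub>G\<^esub> x = x"
  using group_action.id_eq_one[of G UNIV \<phi>] X by (metis G_space_def UNIV_I restrict_apply' topspace_euclidean)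

lemma apply_translate [simp]:
  "g \<in> carrier G \<Longrightarrow> apply_bcontfun (translate \<phi> g f) = (\<lambda>x. f (\<phi> g x))"
proof -
  assume g: "g \<in> carrier G"
  have "(\<lambda>x. f (\<phi> g x)) \<in> bcontfun"
    by (intro bcontfun_normI[of _ "norm f"] norm_bounded
        continuous_on_compose2[of UNIV f UNIV "\<phi> g"] G_space_continuous g) auto
  then show ?thesis by (simp add: translate_def Bcontfun_inverse)
qed

context
  fixes A :: "('x \<Rightarrow>\<^sub>C real) set"
  assumes A: "closed_unital_algebra A" and RUC: "A \<subseteq> RUC G T \<phi>"
    and inv: "\<And>g f. g \<in> carrier G \<Longrightarrow> f \<in> A \<Longrightarrow> translate \<phi> g f \<in> A"
begin

lemma character_action_in_characters:
  assumes g: "g \<in> carrier G" and \<xi>: "\<xi> \<in> characters A"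
  shows "character_action \<phi> A g \<xi> \<in> characters A"
proof -
  have "translate \<phi> g (f + h) = translate \<phi> g f + translate \<phi> g h"
    "translate \<phi> g (times_bcontfun f h) = times_bcontfun (translate \<phi> g f) (translate \<phi> g h)"
    "translate \<phi> g (c *\<^sub>R f) = c *\<^sub>R translate \<phi> g f"
    "translate \<phi> g (const_bcontfun c) = const_bcontfun c" for f h c
    by (intro bcontfun_eqI; simp add: g const_bcontfun.rep_eq)+
  then show ?thesis
    using \<xi> g A
    by (auto simp: characters_def[of A] character_action_def const_bcontfun_mem algebra_ops inv)
qed

lemma character_action_mult:
  assumes g: "g \<in> carrier G" and h: "h \<in> carrier G" and \<xi>: "\<xi> \<in> characters A"
  shows "character_action \<phi> A (g \<otimes>\<^bsub>G\<^esub> h) \<xi> = character_action \<phi> A g (character_action \<phi> A h \<xi>)"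
proof -
  have gh: "g \<otimes>\<^bsub>G\<^esub> h \<in> carrier G"
    using G_space_group g h by (simp add: group.is_monoid monoid.m_closed)
  then have "translate \<phi> (g \<otimes>\<^bsub>G\<^esub> h) f = translate \<phi> h (translate \<phi> g f)" for f
    by (intro bcontfun_eqI) (simp add: g h G_space_mult)
  then show ?thesis
    using character_action_in_characters[OF h \<xi>] \<xi> g inv
    by (auto simp: character_action_def fun_eq_iff)
qed

lemma character_action_one:
  assumes \<xi>: "\<xi> \<in> characters A"
  shows "character_action \<phi> A \<one>\<^bsub>G\<^esub> \<xi> = \<xi>"
proof -
  have "\<one>\<^bsub>G\<^esub> \<in> carrier G" using G_space_group by (simp add: group.is_monoid)
  then have "translate \<phi> \<one>\<^bsub>G\<^esub> f = f" for f
    by (intro bcontfun_eqI) (simp add: G_space_one)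
  moreover have "\<xi> \<in> extensional A" using \<xi> by (simp add: characters_def)
  ultimately show ?thesis
    using \<xi> by (auto simp: character_action_def fun_eq_iff extensional_def)
qed

lemma group_action_character_action: "group_action G (characters A) (character_action \<phi> A)"
proof -
  interpret G: group G by (rule G_space_group)
  let ?E = "characters A" and ?\<psi> = "character_action \<phi> A"
  have bij: "?\<psi> g \<in> Bij ?E" if g: "g \<in> carrier G" for g
  proof -
    have "bij_betw (?\<psi> g) ?E ?E"
    proof (rule bij_betw_byWitness[where f' = "?\<psi> (inv\<^bsub>G\<^esub> g)"])
      show "\<forall>\<xi>\<in>?E. ?\<psi> (inv\<^bsub>G\<^esub> g) (?\<psi> g \<xi>) = \<xi>"
        using character_action_mult[of "inv\<^bsub>G\<^esub> g" g] character_action_one g by simp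
      show "\<forall>\<xi>\<in>?E. ?\<psi> g (?\<psi> (inv\<^bsub>G\<^esub> g) \<xi>) = \<xi>"
        using character_action_mult[of g "inv\<^bsub>G\<^esub> g"] character_action_one g by simp
    qed (use character_action_in_characters g in auto)
    then show ?thesis
      by (simp add: Bij_def character_action_def)
  qed
  have "?\<psi> (g \<otimes>\<^bsub>G\<^esub> h) = compose ?E (?\<psi> g) (?\<psi> h)" if "g \<in> carrier G" "h \<in> carrier G" for g h
    by (rule extensionalityI[of _ ?E])
      (use character_action_mult[OF that] in \<open>auto simp: compose_def character_action_def\<close>)
  then have "?\<psi> \<in> hom G (BijGroup ?E)"
    using bij by (auto simp: hom_def BijGroup_def)
  then show ?thesis
    by (simp add: group_action_def group_hom_def group_hom_axioms_def group_BijGroup G_space_group)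
qed

text \<open>The two variables are separated. Moving \<open>g\<close> changes the translate of
  \<open>f\<close> little in norm, by membership in \<open>RUC\<close>, and this is uniform over
  characters because they do not increase the norm; moving \<open>\<xi>\<close> is tested only on
  the fixed function \<open>f0\<close>.\<close>

lemma continuous_map_character_action:
  "continuous_map (prod_topology T (character_topology A)) (character_topology A)
    (\<lambda>(g, \<xi>). character_action \<phi> A g \<xi>)"
  unfolding continuous_map_into_character_topology[OF A] continuous_map_euclidean_metric
proof (intro conjI ballI allI impI)
  interpret G: group G by (rule G_space_group)
  let ?P = "prod_topology T (character_topology A)"
  have top: "topspace ?P = carrier G \<times> characters A"
    by (simp add: topspace_character_topology[OF A] G_space_topspace)
  show "(case z of (g, \<xi>) \<Rightarrow> character_action \<phi> A g \<xi>) \<in> characters A" if "z \<in> topspace ?P" for z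
    using that character_action_in_characters unfolding top by auto
  fix f z and e :: real
  assume f: "f \<in> A" and z: "z \<in> topspace ?P" and "0 < e"
  obtain g0 \<xi>0 where g0: "z = (g0, \<xi>0)" "g0 \<in> carrier G" "\<xi>0 \<in> characters A"
    using z unfolding top by auto
  obtain V where V: "openin T V" "\<one>\<^bsub>G\<^esub> \<in> V" "\<And>v x. v \<in> V \<Longrightarrow> \<bar>f (\<phi> v x) - f x\<bar> \<le> e / 3"
    using RUC_D[of f G T \<phi> "e / 3"] f RUC \<open>0 < e\<close> by auto
  define f0 where "f0 = translate \<phi> g0 f"
  have f0: "f0 \<in> A" unfolding f0_def by (rule inv[OF g0(2) f])
  \<comment> \<open>Since \<open>g\<close> is its quotient by \<open>g0\<close> following
    \<open>g0\<close>, the translates by \<open>g\<close> and by \<open>g0\<close> differ at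
    \<open>x\<close> as \<open>f\<close> does between \<open>\<phi> g0 x\<close> and its image under
    the quotient.\<close>
  let ?V = "{g \<in> topspace T. g \<otimes>\<^bsub>G\<^esub> inv\<^bsub>G\<^esub> g0 \<in> V}"
  let ?W = "{\<xi> \<in> topspace (character_topology A). \<xi> f0 \<in> ball (\<xi>0 f0) (e / 3)}"
  have "continuous_map T (prod_topology T T) (\<lambda>g. (g, inv\<^bsub>G\<^esub> g0))"
    using g0 by (intro continuous_map_pairedI) (auto simp: G_space_topspace)
  moreover have "continuous_map (prod_topology T T) T (\<lambda>(g, h). g \<otimes>\<^bsub>G\<^esub> h)"
    using X by (simp add: G_space_def topological_group_def)
  ultimately have "continuous_map T T ((\<lambda>(g, h). g \<otimes>\<^bsub>G\<^esub> h) \<circ> (\<lambda>g. (g, inv\<^bsub>G\<^esub> g0)))"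
    by (rule continuous_map_compose)
  then have "continuous_map T T (\<lambda>g. g \<otimes>\<^bsub>G\<^esub> inv\<^bsub>G\<^esub> g0)"
    by (simp add: o_def)
  then have 1: "openin T ?V"
    using V(1) by (rule openin_continuous_map_preimage)
  have 2: "openin (character_topology A) ?W"
    by (rule openin_continuous_map_preimage[OF continuous_map_character_apply[OF A f0]]) simp
  have "openin ?P (?V \<times> ?W)"
    using 1 2 by (simp add: openin_prod_Times_iff)
  moreover have "z \<in> ?V \<times> ?W"
    using g0 V(2) \<open>0 < e\<close> by (simp add: topspace_character_topology[OF A] G_space_topspace)
  moreover have "dist ((case z of (g, \<xi>) \<Rightarrow> character_action \<phi> A g \<xi>) f)
      ((case w of (g, \<xi>) \<Rightarrow> character_action \<phi> A g \<xi>) f) < e" if "w \<in> ?V \<times> ?W" for w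
  proof -
    obtain g \<xi> where w: "w = (g, \<xi>)" "g \<in> carrier G" "g \<otimes>\<^bsub>G\<^esub> inv\<^bsub>G\<^esub> g0 \<in> V" "\<xi> \<in> characters A"
        "\<bar>\<xi>0 f0 - \<xi> f0\<bar> < e / 3"
      using \<open>w \<in> ?V \<times> ?W\<close>
      by (auto simp: topspace_character_topology[OF A] G_space_topspace dist_real_def)
    let ?f = "translate \<phi> g f"
    have fA: "?f \<in> A" by (rule inv[OF w(2) f])
    have "norm (?f - f0) \<le> e / 3"
    proof (rule norm_bound)
      fix x
      have "\<phi> (g \<otimes>\<^bsub>G\<^esub> inv\<^bsub>G\<^esub> g0) (\<phi> g0 x) = \<phi> (g \<otimes>\<^bsub>G\<^esub> inv\<^bsub>G\<^esub> g0 \<otimes>\<^bsub>G\<^esub> g0) x"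
        using w(2) g0(2) by (simp add: G_space_mult)
      also have "g \<otimes>\<^bsub>G\<^esub> inv\<^bsub>G\<^esub> g0 \<otimes>\<^bsub>G\<^esub> g0 = g"
        using w(2) g0(2) by (simp add: G.m_assoc)
      finally show "norm (apply_bcontfun (?f - f0) x) \<le> e / 3"
        using V(3)[OF w(3), of "\<phi> g0 x"] w(2) g0(2) by (simp add: f0_def)
    qed
    then have "\<bar>\<xi> ?f - \<xi> f0\<bar> \<le> e / 3"
      using character_abs_le_norm[OF A w(4) algebra_ops(2)[OF A fA f0]]
        character_diff[OF A w(4) fA f0] by simp
    with w(5) have "\<bar>\<xi>0 f0 - \<xi> ?f\<bar> < e"
      using \<open>0 < e\<close> by linarith
    then show ?thesis
      using w g0 f by (simp add: character_action_def dist_real_def f0_def[symmetric])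
  qed
  ultimately show "\<exists>U. openin ?P U \<and> z \<in> U \<and>
      (\<forall>w\<in>U. dist ((case z of (g, \<xi>) \<Rightarrow> character_action \<phi> A g \<xi>) f)
        ((case w of (g, \<xi>) \<Rightarrow> character_action \<phi> A g \<xi>) f) < e)"
    by blast
qed

lemma equivariant_compactification_characters:
  "equivariant_compactification G T euclidean \<phi>
    (character_topology A) (character_action \<phi> A) (evaluation A)"
proof -
  have "evaluation A (\<phi> g x) = character_action \<phi> A g (evaluation A x)" if "g \<in> carrier G" for g x
    using that inv evaluation_in_characters[OF A]
    by (auto simp: character_action_def evaluation_def fun_eq_iff)
  moreover have "G_space G T (character_topology A) (character_action \<phi> A)"
    using X A group_action_character_action continuous_map_character_action
    by (simp add: G_space_def completely_regular_space_character_topology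
        Hausdorff_space_character_topology topspace_character_topology)
  ultimately show ?thesis
    using X A by (simp add: equivariant_compactification_def compact_space_character_topology
        continuous_map_evaluation evaluation_dense topspace_character_topology)
qed

end

text \<open>Applying \<open>v\<close> and then \<open>g\<close> equals applying \<open>g\<close> and
  then the conjugate of \<open>v\<close> by \<open>g\<close>. The neighbourhood for the translate is
  therefore the preimage of the one for \<open>f\<close> under conjugation.\<close>

lemma translate_in_RUC:
  assumes g: "g \<in> carrier G" and f: "f \<in> RUC G T \<phi>"
  shows "translate \<phi> g f \<in> RUC G T \<phi>"
proof (rule RUC_I)
  interpret G: group G by (rule G_space_group)
  fix e :: real assume "0 < e"
  then obtain V where V: "openin T V" "\<one>\<^bsub>G\<^esub> \<in> V" "\<And>v x. v \<in> V \<Longrightarrow> \<bar>f (\<phi> v x) - f x\<bar> \<le> e"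
    using RUC_D[OF f] by blast
  let ?c = "\<lambda>v. g \<otimes>\<^bsub>G\<^esub> (v \<otimes>\<^bsub>G\<^esub> inv\<^bsub>G\<^esub> g)"
  have mult: "continuous_map T T (\<lambda>v. a v \<otimes>\<^bsub>G\<^esub> b v)"
    if "continuous_map T T a" "continuous_map T T b" for a b
  proof -
    have "continuous_map (prod_topology T T) T (\<lambda>(g, h). g \<otimes>\<^bsub>G\<^esub> h)"
      using X by (simp add: G_space_def topological_group_def)
    from continuous_map_compose[OF continuous_map_pairedI[OF that] this]
    show ?thesis by (simp add: o_def)
  qed
  have "continuous_map T T ?c"
    using g by (intro mult) (auto simp: G_space_topspace)
  then have "openin T {v \<in> topspace T. ?c v \<in> V}"
    using V(1) by (rule openin_continuous_map_preimage)
  moreover have "\<bar>translate \<phi> g f (\<phi> v x) - translate \<phi> g f x\<bar> \<le> e"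
    if "v \<in> carrier G" "?c v \<in> V" for v x
  proof -
    have "\<phi> (?c v) (\<phi> g x) = \<phi> (?c v \<otimes>\<^bsub>G\<^esub> g) x"
      using that(1) g by (simp add: G_space_mult)
    also have "?c v \<otimes>\<^bsub>G\<^esub> g = g \<otimes>\<^bsub>G\<^esub> v"
      using that(1) g by (simp add: G.m_assoc)
    finally show ?thesis
      using V(3)[OF that(2), of "\<phi> g x"] that(1) g by (simp add: G_space_mult)
  qed
  ultimately show "\<exists>V. openin T V \<and> \<one>\<^bsub>G\<^esub> \<in> V \<and>
      (\<forall>v\<in>V. \<forall>x. \<bar>translate \<phi> g f (\<phi> v x) - translate \<phi> g f x\<bar> \<le> e)"
    using V(2) g by (intro exI[of _ "{v \<in> topspace T. ?c v \<in> V}"]) (auto simp: G_space_topspace)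
qed

lemma closed_unital_algebra_RUC: "closed_unital_algebra (RUC G T \<phi>)"
proof -
  let ?R = "RUC G T \<phi>"
  have one: "\<one>\<^bsub>G\<^esub> \<in> topspace T"
    using G_space_group by (simp add: G_space_topspace group.is_monoid)
  have both: "\<exists>V. openin T V \<and> \<one>\<^bsub>G\<^esub> \<in> V \<and>
      (\<forall>v\<in>V. \<forall>x. \<bar>f (\<phi> v x) - f x\<bar> \<le> e \<and> \<bar>g (\<phi> v x) - g x\<bar> \<le> e)"
    if fg: "f \<in> ?R" "g \<in> ?R" and "0 < e" for f g e
  proof -
    obtain V where V: "openin T V" "\<one>\<^bsub>G\<^esub> \<in> V" "\<And>v x. v \<in> V \<Longrightarrow> \<bar>f (\<phi> v x) - f x\<bar> \<le> e"
      using RUC_D[OF fg(1) \<open>0 < e\<close>] by blast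
    obtain W where W: "openin T W" "\<one>\<^bsub>G\<^esub> \<in> W" "\<And>v x. v \<in> W \<Longrightarrow> \<bar>g (\<phi> v x) - g x\<bar> \<le> e"
      using RUC_D[OF fg(2) \<open>0 < e\<close>] by blast
    show ?thesis
      using V W by (intro exI[of _ "V \<inter> W"]) auto
  qed
  have const: "const_bcontfun c \<in> ?R" for c
    by (rule RUC_I) (use one in \<open>auto simp: const_bcontfun.rep_eq intro!: exI[of _ "topspace T"]\<close>)
  have add: "f + g \<in> ?R" if fg: "f \<in> ?R" "g \<in> ?R" for f g
  proof (rule RUC_I)
    fix e :: real assume "0 < e"
    then obtain V where V: "openin T V" "\<one>\<^bsub>G\<^esub> \<in> V"
      "\<forall>v\<in>V. \<forall>x. \<bar>f (\<phi> v x) - f x\<bar> \<le> e / 2 \<and> \<bar>g (\<phi> v x) - g x\<bar> \<le> e / 2"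
      using both[OF fg, of "e / 2"] by auto
    have "\<bar>(f + g) (\<phi> v x) - (f + g) x\<bar> \<le> e" if "v \<in> V" for v x
      using V(3)[rule_format, OF that, of x] unfolding plus_bcontfun.rep_eq by linarith
    then show "\<exists>V. openin T V \<and> \<one>\<^bsub>G\<^esub> \<in> V \<and> (\<forall>v\<in>V. \<forall>x. \<bar>(f + g) (\<phi> v x) - (f + g) x\<bar> \<le> e)"
      using V(1,2) by blast
  qed
  have times: "times_bcontfun f g \<in> ?R" if fg: "f \<in> ?R" "g \<in> ?R" for f g
  proof (rule RUC_I)
    fix e :: real assume "0 < e"
    \<comment> \<open>The product rule gives an error of \<open>e / B\<close> times
      \<open>norm f + norm g\<close>; the extra 1 keeps the divisor positive.\<close>
    define B where "B = norm f + norm g + 1"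
    have B: "0 < B" using norm_ge_zero[of f] norm_ge_zero[of g] unfolding B_def by linarith
    obtain V where V: "openin T V" "\<one>\<^bsub>G\<^esub> \<in> V"
      "\<forall>v\<in>V. \<forall>x. \<bar>f (\<phi> v x) - f x\<bar> \<le> e / B \<and> \<bar>g (\<phi> v x) - g x\<bar> \<le> e / B"
      using both[OF fg, of "e / B"] \<open>0 < e\<close> B by auto
    have "\<bar>times_bcontfun f g (\<phi> v x) - times_bcontfun f g x\<bar> \<le> e" if "v \<in> V" for v x
    proof -
      let ?y = "\<phi> v x"
      have "times_bcontfun f g ?y - times_bcontfun f g x = f ?y * (g ?y - g x) + (f ?y - f x) * g x"
        by (simp add: algebra_simps)
      also have "\<bar>\<dots>\<bar> \<le> \<bar>f ?y\<bar> * \<bar>g ?y - g x\<bar> + \<bar>f ?y - f x\<bar> * \<bar>g x\<bar>"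
        by (metis abs_mult abs_triangle_ineq)
      also have "\<dots> \<le> norm f * (e / B) + (e / B) * norm g"
        using V(3)[rule_format, OF that, of x] norm_bounded[of f ?y] norm_bounded[of g x] \<open>0 < e\<close> B
        by (intro add_mono mult_mono) auto
      also have "\<dots> = (e / B) * (norm f + norm g)"
        by (simp add: algebra_simps)
      also have "\<dots> \<le> (e / B) * B"
        using \<open>0 < e\<close> B by (intro mult_left_mono) (auto simp: B_def)
      finally show ?thesis using B by simp
    qed
    then show "\<exists>V. openin T V \<and> \<one>\<^bsub>G\<^esub> \<in> V \<and>
        (\<forall>v\<in>V. \<forall>x. \<bar>times_bcontfun f g (\<phi> v x) - times_bcontfun f g x\<bar> \<le> e)"
      using V(1,2) by blast
  qed
  have scale: "c *\<^sub>R f \<in> ?R" if "f \<in> ?R" for c f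
  proof -
    have "c *\<^sub>R f = times_bcontfun (const_bcontfun c) f"
      by (intro bcontfun_eqI) (simp add: const_bcontfun.rep_eq)
    then show ?thesis using times[OF const that] by simp
  qed
  have "f \<in> ?R" if f: "f \<in> closure ?R" for f
  proof (rule RUC_I)
    fix e :: real assume "0 < e"
    then have "0 < e / 3" by simp
    then obtain g where g: "g \<in> ?R" "dist g f < e / 3"
      using f unfolding closure_approachable by blast
    obtain V where V: "openin T V" "\<one>\<^bsub>G\<^esub> \<in> V" "\<And>v x. v \<in> V \<Longrightarrow> \<bar>g (\<phi> v x) - g x\<bar> \<le> e / 3"
      using RUC_D[OF g(1) \<open>0 < e / 3\<close>] by blast
    have "\<bar>f (\<phi> v x) - f x\<bar> \<le> e" if "v \<in> V" for v x
    proof -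
      have "\<bar>g y - f y\<bar> < e / 3" for y
        using dist_fun_lt_imp_dist_val_lt[OF g(2), of y] by (simp add: dist_real_def)
      from this[of x] this[of "\<phi> v x"] V(3)[OF that, of x] show ?thesis by linarith
    qed
    then show "\<exists>V. openin T V \<and> \<one>\<^bsub>G\<^esub> \<in> V \<and> (\<forall>v\<in>V. \<forall>x. \<bar>f (\<phi> v x) - f x\<bar> \<le> e)"
      using V(1,2) by blast
  qed
  then have "closed ?R"
    unfolding closure_subset_eq[symmetric] by blast
  moreover have "subspace ?R"
    using const[of 0] add scale by (simp add: subspace_def)
  ultimately show ?thesis
    using const times by (simp add: closed_unital_algebra_def unital_subalgebra_def)
qed

text \<open>\<open>RUC\<close> meets two opposite demands: its functions are uniform enough for the
  action on characters to be jointly continuous, and it contains every function pulled back from an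
  equivariant compactification. The type \<open>'k\<close> of the competitors is arbitrary.\<close>

lemma greatest_equivariant_compactification_RUC:
  "greatest_equivariant_compactification TYPE('k) G T euclidean \<phi>
    (character_topology (RUC G T \<phi>)) (character_action \<phi> (RUC G T \<phi>)) (evaluation (RUC G T \<phi>))"
  unfolding greatest_equivariant_compactification_def
proof (intro conjI allI impI)
  show "equivariant_compactification G T euclidean \<phi> (character_topology (RUC G T \<phi>))
      (character_action \<phi> (RUC G T \<phi>)) (evaluation (RUC G T \<phi>))"
    by (rule equivariant_compactification_characters[OF closed_unital_algebra_RUC])
      (auto intro: translate_in_RUC)
  fix K :: "'k topology" and \<psi> \<nu>
  assume K: "equivariant_compactification G T euclidean \<phi> K \<psi> \<nu>"
  then have "compact_space K" "Hausdorff_space K" "completely_regular_space K"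
    "continuous_map euclidean K \<nu>"
    by (auto simp: equivariant_compactification_def G_space_def)
  then show "compactification_factor euclidean K \<nu>
      (character_topology (RUC G T \<phi>)) (evaluation (RUC G T \<phi>))"
    by (intro compactification_factor_of_character_topology closed_unital_algebra_RUC
        compactification_pullback_in_RUC[OF K]) (auto simp: continuous_map_def)
qed

end

section \<open>The Gromov compactification of the Urysohn sphere\<close>

lemma Iso_simps [simp]: "x \<otimes>\<^bsub>Iso\<^esub> y = x \<circ> y" "\<one>\<^bsub>Iso\<^esub> = id"
  by (simp_all add: Iso_def)

lemma Iso_dist: "g \<in> carrier Iso \<Longrightarrow> dist (g x) (g y) = dist x y"
  by (simp add: Iso_carrier_iff)

lemma Iso_inverse_mem:
  assumes "g \<in> carrier Iso" shows "Hilbert_Choice.inv g \<in> carrier Iso"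
proof -
  have g: "bij g" using assms by (simp add: Iso_carrier_iff)
  have "dist (Hilbert_Choice.inv g x) (Hilbert_Choice.inv g y) = dist x y" for x y
    using Iso_dist[OF assms, of "Hilbert_Choice.inv g x" "Hilbert_Choice.inv g y"] g
    by (simp add: bij_is_surj surj_f_inv_f)
  then show ?thesis
    using g by (simp add: Iso_carrier_iff bij_imp_bij_inv)
qed

lemma group_Iso: "group Iso"
proof (rule groupI)
  show "x \<otimes>\<^bsub>Iso\<^esub> y \<in> carrier Iso" if "x \<in> carrier Iso" "y \<in> carrier Iso" for x y :: "'a \<Rightarrow> 'a"
    using that by (simp add: Iso_carrier_iff bij_comp)
  show "\<exists>y\<in>carrier Iso. y \<otimes>\<^bsub>Iso\<^esub> x = \<one>\<^bsub>Iso\<^esub>" if "x \<in> carrier Iso" for x :: "'a \<Rightarrow> 'a"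
    using that Iso_inverse_mem[OF that]
    by (intro bexI[of _ "Hilbert_Choice.inv x"]) (auto simp: Iso_carrier_iff bij_is_inj)
qed (auto simp: Iso_carrier_iff o_assoc)

lemma inv_Iso: "g \<in> carrier Iso \<Longrightarrow> inv\<^bsub>Iso\<^esub> g = Hilbert_Choice.inv g"
  by (intro group.inv_equality[OF group_Iso] Iso_inverse_mem)
    (simp_all add: Iso_carrier_iff bij_is_inj)

lemma topspace_Iso_topology: "topspace Iso_topology = carrier Iso"
  by (simp add: Iso_topology_def)

lemma continuous_map_into_Iso_topology:
  "continuous_map X Iso_topology F \<longleftrightarrow>
    (\<forall>z\<in>topspace X. F z \<in> carrier Iso) \<and> (\<forall>x. continuous_map X euclidean (\<lambda>z. F z x))"
  by (auto simp: Iso_topology_def continuous_map_in_subtopology continuous_map_componentwise_UNIV)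

lemma openin_Iso_topology_dist_less:
  fixes x y :: "'a::metric_space"
  shows "openin Iso_topology {g \<in> carrier Iso. dist (g x) y < e}"
proof -
  have "continuous_map Iso_topology euclidean (\<lambda>g. g x)"
    using continuous_map_into_Iso_topology[of "Iso_topology :: ('a \<Rightarrow> 'a) topology" id] by simp
  from openin_continuous_map_preimage[OF this, of "ball y e"]
  show ?thesis by (simp add: topspace_Iso_topology dist_commute)
qed

text \<open>Pointwise control suffices because group elements preserve distances: in a product the
  error of the inner factor passes unchanged through the outer one, and for the inverse at
  \<open>x\<close> the error equals that of \<open>k\<close> at the preimage \<open>y\<close> of
  \<open>x\<close> under \<open>g\<close>.\<close>

lemma topological_group_Iso: "topological_group Iso (Iso_topology :: ('a::metric_space \<Rightarrow> 'a) topology)"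
proof -
  let ?T = "Iso_topology :: ('a \<Rightarrow> 'a) topology"
  have "continuous_map (prod_topology ?T ?T) ?T (\<lambda>(g, h). g \<circ> h)"
    unfolding continuous_map_into_Iso_topology continuous_map_euclidean_metric
  proof (intro conjI ballI allI impI)
    fix z assume z: "z \<in> topspace (prod_topology ?T ?T)"
    then obtain g h where gh: "z = (g, h)" "g \<in> carrier Iso" "h \<in> carrier Iso"
      by (auto simp: topspace_Iso_topology)
    then show "(case z of (g, h) \<Rightarrow> g \<circ> h) \<in> carrier Iso"
      by (simp add: Iso_carrier_iff bij_comp)
    fix x :: 'a and e :: real assume "0 < e"
    let ?U = "{k \<in> carrier Iso. dist (k (h x)) (g (h x)) < e / 2}"
    let ?V = "{k \<in> carrier Iso. dist (k x) (h x) < e / 2}"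
    have "openin (prod_topology ?T ?T) (?U \<times> ?V)"
      by (intro openin_prod_Times_iff[THEN iffD2] disjI2 conjI openin_Iso_topology_dist_less)
    moreover have "z \<in> ?U \<times> ?V" using gh \<open>0 < e\<close> by simp
    moreover have "dist ((case z of (g, h) \<Rightarrow> g \<circ> h) x) ((case w of (g, h) \<Rightarrow> g \<circ> h) x) < e"
      if "w \<in> ?U \<times> ?V" for w
    proof -
      obtain g' h' where w: "w = (g', h')" "g' \<in> carrier Iso" "h' \<in> carrier Iso"
        "dist (g' (h x)) (g (h x)) < e / 2" "dist (h' x) (h x) < e / 2"
        using \<open>w \<in> ?U \<times> ?V\<close> by auto
      have "dist (g (h x)) (g' (h' x)) \<le> dist (g (h x)) (g' (h x)) + dist (g' (h x)) (g' (h' x))"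
        by (rule dist_triangle)
      also have "\<dots> < e"
        using w(4,5) Iso_dist[OF w(2)] by (simp add: dist_commute)
      finally show ?thesis using gh w(1) by simp
    qed
    ultimately show "\<exists>U. openin (prod_topology ?T ?T) U \<and> z \<in> U \<and>
        (\<forall>w\<in>U. dist ((case z of (g, h) \<Rightarrow> g \<circ> h) x) ((case w of (g, h) \<Rightarrow> g \<circ> h) x) < e)"
      by blast
  qed
  moreover have "continuous_map ?T ?T (\<lambda>g. inv\<^bsub>Iso\<^esub> g)"
    unfolding continuous_map_into_Iso_topology continuous_map_euclidean_metric
  proof (intro conjI ballI allI impI)
    fix g assume "g \<in> topspace ?T"
    then have g: "g \<in> carrier Iso" by (simp add: topspace_Iso_topology)
    then show "inv\<^bsub>Iso\<^esub> g \<in> carrier Iso" by (simp add: inv_Iso Iso_inverse_mem)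
    fix x :: 'a and e :: real assume "0 < e"
    define y where "y = Hilbert_Choice.inv g x"
    have y: "g y = x" using g by (simp add: y_def Iso_carrier_iff bij_is_surj surj_f_inv_f)
    let ?U = "{k \<in> carrier Iso. dist (k y) (g y) < e}"
    have "dist ((inv\<^bsub>Iso\<^esub> g) x) ((inv\<^bsub>Iso\<^esub> k) x) < e" if k: "k \<in> ?U" for k
    proof -
      have "bij k" using k by (simp add: Iso_carrier_iff)
      then have "dist (k y) (k (Hilbert_Choice.inv k x)) < e"
        using k y by (simp add: bij_is_surj surj_f_inv_f)
      then show ?thesis
        using k g by (simp add: inv_Iso Iso_dist y_def)
    qed
    then show "\<exists>U. openin ?T U \<and> g \<in> U \<and> (\<forall>k\<in>U. dist ((inv\<^bsub>Iso\<^esub> g) x) ((inv\<^bsub>Iso\<^esub> k) x) < e)"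
      using g \<open>0 < e\<close> by (intro exI[of _ ?U]) (simp add: openin_Iso_topology_dist_less)
  qed
  ultimately show ?thesis
    by (simp add: topological_group_def group_Iso topspace_Iso_topology)
qed

lemma G_space_Iso: "G_space Iso Iso_topology (euclidean :: 'a::metric_space topology) (\<lambda>g. g)"
proof -
  let ?T = "Iso_topology :: ('a \<Rightarrow> 'a) topology"
  have "(\<lambda>g. g) \<in> hom (Iso :: ('a \<Rightarrow> 'a) monoid) (BijGroup UNIV)"
    by (auto simp: hom_def BijGroup_def Bij_def Iso_carrier_iff compose_def fun_eq_iff)
  then have "group_action Iso (UNIV :: 'a set) (\<lambda>g. g)"
    by (simp add: group_action_def group_hom_def group_hom_axioms_def group_BijGroup group_Iso)
  moreover have "continuous_map (prod_topology ?T euclidean) euclidean (\<lambda>(g, x). g x)"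
    unfolding continuous_map_euclidean_metric
  proof (intro ballI allI impI)
    fix z :: "('a \<Rightarrow> 'a) \<times> 'a" and e :: real
    assume "z \<in> topspace (prod_topology ?T euclidean)" "0 < e"
    then obtain g x where z: "z = (g, x)" "g \<in> carrier Iso"
      by (auto simp: topspace_Iso_topology)
    let ?U = "{k \<in> carrier Iso. dist (k x) (g x) < e / 2}"
    have "openin (prod_topology ?T euclidean) (?U \<times> ball x (e / 2))"
      by (intro openin_prod_Times_iff[THEN iffD2] disjI2 conjI openin_Iso_topology_dist_less) simp
    moreover have "z \<in> ?U \<times> ball x (e / 2)" using z \<open>0 < e\<close> by simp
    moreover have "dist (case z of (g, x) \<Rightarrow> g x) (case w of (g, x) \<Rightarrow> g x) < e"
      if "w \<in> ?U \<times> ball x (e / 2)" for w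
    proof -
      obtain k y where w: "w = (k, y)" "k \<in> carrier Iso" "dist (k x) (g x) < e / 2" "dist x y < e / 2"
        using \<open>w \<in> ?U \<times> ball x (e / 2)\<close> by auto
      have "dist (g x) (k y) \<le> dist (g x) (k x) + dist (k x) (k y)" by (rule dist_triangle)
      also have "\<dots> < e" using w(3,4) Iso_dist[OF w(2)] by (simp add: dist_commute)
      finally show ?thesis using z w(1) by simp
    qed
    ultimately show "\<exists>U. openin (prod_topology ?T euclidean) U \<and> z \<in> U \<and>
        (\<forall>w\<in>U. dist (case z of (g, x) \<Rightarrow> g x) (case w of (g, x) \<Rightarrow> g x) < e)"
      by blast
  qed
  ultimately show ?thesis
    by (simp add: G_space_def topological_group_Iso metrizable_imp_completely_regular_space
        metrizable_space_euclidean)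
qed

text \<open>As \<open>g\<close> preserves \<open>dist x z\<close>, the change of the function under
  \<open>g\<close> is at most \<open>dist (g z) z\<close>, uniformly in \<open>x\<close>; a
  neighbourhood testing \<open>z\<close> alone is enough.\<close>

lemma dist_in_RUC:
  assumes "apply_bcontfun f = (\<lambda>x. dist x z)"
  shows "f \<in> RUC Iso Iso_topology (\<lambda>g. g)"
proof (rule RUC_I)
  fix e :: real assume "0 < e"
  have "\<bar>f (g x) - f x\<bar> \<le> e" if "g \<in> carrier Iso" "dist (g z) z < e" for g x
  proof -
    have "\<bar>dist (g x) z - dist (g x) (g z)\<bar> \<le> dist (g z) z" by metric
    then show ?thesis
      using that Iso_dist[OF that(1), of x z] by (simp add: assms)
  qed
  then show "\<exists>V. openin Iso_topology V \<and> \<one>\<^bsub>Iso\<^esub> \<in> V \<and> (\<forall>g\<in>V. \<forall>x. \<bar>f (g x) - f x\<bar> \<le> e)"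
    using \<open>0 < e\<close> group.is_monoid[OF group_Iso, THEN monoid.one_closed]
    by (intro exI[of _ "{g \<in> carrier Iso. dist (g z) z < e}"])
      (simp add: openin_Iso_topology_dist_less)
qed

lemma gromov_algebra_subset_RUC: "gromov_algebra \<subseteq> RUC Iso Iso_topology (\<lambda>g. g)"
  unfolding gromov_algebra_def
  by (rule closed_unital_algebra_generated_minimal)
    (auto intro: dist_in_RUC closed_unital_algebra_RUC[OF G_space_Iso])

lemma urysohn_RUC_modulus:
  fixes f :: "'a::polish_space \<Rightarrow>\<^sub>C real"
  assumes U: "urysohn_sphere TYPE('a)" and f: "f \<in> RUC Iso Iso_topology (\<lambda>g. g)" and "0 < e"
  obtains F \<delta> where "finite F" "0 < \<delta>"
    "\<And>x y. (\<And>a. a \<in> F \<Longrightarrow> \<bar>dist x a - dist y a\<bar> \<le> \<delta>) \<Longrightarrow> \<bar>f x - f y\<bar> \<le> e"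
proof -
  obtain V where V: "openin Iso_topology V" "id \<in> V" "\<And>g x. g \<in> V \<Longrightarrow> \<bar>f (g x) - f x\<bar> \<le> e"
    using RUC_D[OF f \<open>0 < e\<close>] by auto
  obtain W where W: "openin (product_topology (\<lambda>_. euclidean) UNIV) W" "V = W \<inter> carrier Iso"
    using V(1) by (auto simp: Iso_topology_def openin_subtopology)
  obtain P r where P: "finite P" "0 < r" "\<And>g. (\<And>a. a \<in> P \<Longrightarrow> dist (g a) a < r) \<Longrightarrow> g \<in> W"
    using product_topology_metric_nhd[OF W(1), of id] V(2) W(2) by auto
  \<comment> \<open>Homogeneity bounds displacements only weakly; half the radius turns this into
    the strict bound required by the neighbourhood.\<close>
  have "\<bar>f x - f y\<bar> \<le> e" if xy: "\<And>a. a \<in> P \<Longrightarrow> \<bar>dist x a - dist y a\<bar> \<le> r / 2" for x y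
  proof -
    obtain g where g: "g \<in> carrier Iso" "g x = y" "\<And>a. a \<in> P \<Longrightarrow> dist (g a) a \<le> r / 2"
      using urysohn_approximate_homogeneity[OF U P(1) xy] \<open>0 < r\<close> by auto
    have "g \<in> W"
    proof (rule P(3))
      show "dist (g a) a < r" if "a \<in> P" for a
        using g(3)[OF that] \<open>0 < r\<close> by linarith
    qed
    then show ?thesis
      using V(3)[of g x] g(1,2) W(2) by (simp add: abs_minus_commute)
  qed
  then show ?thesis
    using that[of P "r / 2"] P(1,2) by simp
qed

definition dist_bcontfun :: "'a::metric_space \<Rightarrow> 'a \<Rightarrow>\<^sub>C real" where
  "dist_bcontfun z = Bcontfun (\<lambda>x. dist x z)"

lemma apply_dist_bcontfun:
  assumes "bounded (UNIV :: 'a::metric_space set)"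
  shows "apply_bcontfun (dist_bcontfun z) = (\<lambda>x::'a. dist x z)"
proof -
  obtain b where b: "\<And>x. dist z (x::'a) \<le> b"
    using assms bounded_any_center[of UNIV z] by auto
  have "(\<lambda>x. dist x z) \<in> bcontfun"
    using b by (intro bcontfun_normI[of _ b] continuous_intros) (simp add: dist_commute)
  then show ?thesis by (simp add: dist_bcontfun_def Bcontfun_inverse)
qed

lemma gromov_algebra_eq:
  assumes "bounded (UNIV :: 'a::metric_space set)"
  shows "gromov_algebra = closed_unital_algebra_generated (range (dist_bcontfun :: 'a \<Rightarrow> _))"
proof -
  have "{f. \<exists>z::'a. apply_bcontfun f = (\<lambda>x. dist x z)} = range dist_bcontfun"
    by (auto simp: apply_dist_bcontfun[OF assms] image_iff simp flip: apply_bcontfun_inject)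
  then show ?thesis by (simp add: gromov_algebra_def)
qed

theorem urysohn_RUC_eq_gromov_algebra:
  assumes U: "urysohn_sphere TYPE('a::polish_space)"
  shows "RUC (Iso :: ('a \<Rightarrow> 'a) monoid) Iso_topology (\<lambda>g. g) = gromov_algebra"
proof (intro antisym subsetI)
  have bdd: "bounded (UNIV :: 'a set)" using U by (simp add: urysohn_sphere_def)
  have A: "closed_unital_algebra (gromov_algebra :: ('a \<Rightarrow>\<^sub>C real) set)"
    by (simp add: gromov_algebra_def closed_unital_algebra_generated)
  fix f :: "'a \<Rightarrow>\<^sub>C real" assume f: "f \<in> RUC Iso Iso_topology (\<lambda>g. g)"
  have "apply_bcontfun f \<in> apply_bcontfun ` gromov_algebra"
  proof (rule algebra_uniform_limit[OF A])
    fix e :: real assume "0 < e"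
    \<comment> \<open>The McShane approximant loses a factor 2 against the modulus.\<close>
    then have "0 < e / 2" by simp
    then obtain F \<delta> where F: "finite F" "0 < \<delta>"
      "\<And>x y. (\<And>a. a \<in> F \<Longrightarrow> \<bar>dist x a - dist y a\<bar> \<le> \<delta>) \<Longrightarrow> \<bar>f x - f y\<bar> \<le> e / 2"
      using urysohn_RUC_modulus[OF U f] by blast
    have "dist_bcontfun ` F \<subseteq> gromov_algebra"
      using subset_closed_unital_algebra_generated[of "range dist_bcontfun"]
      by (auto simp: gromov_algebra_eq[OF bdd])
    then have "\<exists>h\<in>gromov_algebra. \<forall>x. \<bar>apply_bcontfun h x - f x\<bar> \<le> 2 * (e / 2)"
    proof (rule algebra_approximation[OF A finite_imageI[OF F(1)] _ F(2) \<open>0 < e / 2\<close>])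
      fix x y assume "\<And>p. p \<in> dist_bcontfun ` F \<Longrightarrow> \<bar>apply_bcontfun p x - apply_bcontfun p y\<bar> \<le> \<delta>"
      then have "\<bar>dist x a - dist y a\<bar> \<le> \<delta>" if "a \<in> F" for a
        using that by (metis apply_dist_bcontfun[OF bdd] imageI)
      then show "\<bar>f x - f y\<bar> \<le> e / 2" by (rule F(3))
    qed
    then show "\<exists>\<psi>\<in>apply_bcontfun ` gromov_algebra. \<forall>x. \<bar>\<psi> x - f x\<bar> \<le> e"
      by auto
  qed (rule apply_bcontfun)
  then show "f \<in> gromov_algebra"
    by (auto simp: apply_bcontfun_inject)
qed (use gromov_algebra_subset_RUC in blast)

text \<open>The set on which two characters agree is itself a closed unital algebra, so agreement
  spreads from a dense part of the generators to all of \<open>A\<close>. This is what reduces the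
  Gromov compactification to countably many coordinates.\<close>

lemma characters_eqI:
  fixes S S' :: "('a::topological_space \<Rightarrow>\<^sub>C real) set"
  defines "A \<equiv> closed_unital_algebra_generated S"
  assumes \<xi>: "\<xi> \<in> characters A" and \<eta>: "\<eta> \<in> characters A"
    and S': "S' \<subseteq> A" "S \<subseteq> closure S'" and eq: "\<And>f. f \<in> S' \<Longrightarrow> \<xi> f = \<eta> f"
  shows "\<xi> = \<eta>"
proof -
  have A: "closed_unital_algebra A"
    unfolding A_def by (rule closed_unital_algebra_generated)
  define E where "E = {f \<in> A. \<xi> f = \<eta> f}"
  \<comment> \<open>Closedness of the agreement set: both characters are 1-Lipschitz for the
    norm.\<close>
  have "f \<in> E" if "f \<in> closure E" for f
  proof -
    have "closure E \<subseteq> A"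
      using A by (intro closure_minimal) (auto simp: E_def closed_unital_algebra_def)
    then have fA: "f \<in> A" using that by blast
    have "\<bar>\<xi> f - \<eta> f\<bar> \<le> 0 + e" if "0 < e" for e
    proof -
      have "0 < e / 2" using that by simp
      then obtain g where g: "g \<in> E" "dist g f < e / 2"
        using \<open>f \<in> closure E\<close> unfolding closure_approachable by blast
      then have gA: "g \<in> A" "\<xi> g = \<eta> g" by (auto simp: E_def)
      have "\<bar>\<zeta> f - \<zeta> g\<bar> \<le> e / 2" if \<zeta>: "\<zeta> \<in> characters A" for \<zeta>
        using character_abs_le_norm[OF A \<zeta> algebra_ops(2)[OF A fA gA(1)]] g(2)
          character_diff[OF A \<zeta> fA gA(1)] by (simp add: dist_norm norm_minus_commute)
      from this[OF \<xi>] this[OF \<eta>] show ?thesis using gA(2) by linarith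
    qed
    then have "\<bar>\<xi> f - \<eta> f\<bar> \<le> 0" by (rule field_le_epsilon)
    then show ?thesis using fA by (simp add: E_def)
  qed
  then have clE: "closed E" unfolding closure_subset_eq[symmetric] by blast
  have "0 \<in> A" "\<xi> 0 = 0" "\<eta> 0 = 0"
    using const_bcontfun_mem[OF A, of 0] character_const[OF A \<xi>, of 0] character_const[OF A \<eta>, of 0]
    by simp_all
  then have "subspace E"
    using \<xi> \<eta> A by (auto simp: subspace_def E_def algebra_ops character_add character_scale)
  then have "closed_unital_algebra E"
    unfolding closed_unital_algebra_def[of E] unital_subalgebra_def using clE \<xi> \<eta> A
    by (intro conjI) (auto simp: E_def algebra_ops const_bcontfun_mem character_const character_times)
  moreover have "S \<subseteq> E"
    using S' eq closure_minimal[OF _ clE, of S'] by (auto simp: E_def)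
  ultimately have "A \<subseteq> E"
    unfolding A_def by (intro closed_unital_algebra_generated_minimal)
  moreover have "\<xi> \<in> extensional A" "\<eta> \<in> extensional A"
    using \<xi> \<eta> by (auto simp: characters_def)
  ultimately show ?thesis
    by (intro extensionalityI[of _ A]) (auto simp: E_def)
qed

text \<open>A continuous map from a compact space to a Hausdorff space is closed, so an injective
  one is an embedding.\<close>

lemma metrizable_space_compact_injection:
  assumes "compact_space X" "metrizable_space Y" "continuous_map X Y f" "inj_on f (topspace X)"
  shows "metrizable_space X"
proof -
  have "closed_map X Y f"
    using assms by (intro continuous_imp_closed_map_gen)
      (auto intro: Hausdorff_imp_kc_space metrizable_imp_Hausdorff_space)
  then have "X homeomorphic_space subtopology Y (f ` topspace X)"
    using assms by (intro embedding_map_imp_homeomorphic_space injective_closed_imp_embedding_map)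
  then show ?thesis
    using assms(2) homeomorphic_metrizable_space metrizable_space_subtopology by blast
qed

text \<open>Recording a character only at the distance functions of a countable dense set
  \<open>D\<close> is a continuous injection into a countable power of the real line.\<close>

lemma metrizable_gromov_compactification:
  assumes bdd: "bounded (UNIV :: 'a::{metric_space, second_countable_topology} set)"
  shows "metrizable_space (gromov_compactification :: (('a \<Rightarrow>\<^sub>C real) \<Rightarrow> real) topology)"
proof -
  let ?A = "gromov_algebra :: ('a \<Rightarrow>\<^sub>C real) set"
  have A: "closed_unital_algebra ?A"
    by (simp add: gromov_algebra_def closed_unital_algebra_generated)
  have dA: "dist_bcontfun z \<in> ?A" for z
    using subset_closed_unital_algebra_generated[of "range dist_bcontfun"]
    by (auto simp: gromov_algebra_eq[OF bdd])
  obtain D :: "'a set" where D: "countable D" "\<And>X. open X \<Longrightarrow> X \<noteq> {} \<Longrightarrow> \<exists>d\<in>D. d \<in> X"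
    using countable_dense_setE by blast
  let ?Y = "product_topology (\<lambda>_. euclideanreal) D"
  let ?F = "\<lambda>\<xi>. \<lambda>z\<in>D. \<xi> (dist_bcontfun z)"
  \<comment> \<open>The Kuratowski map sending \<open>z\<close> to \<open>dist_bcontfun z\<close> is
    1-Lipschitz into the sup norm, so it carries density of \<open>D\<close> over to the
    generators.\<close>
  have dense: "range dist_bcontfun \<subseteq> closure (dist_bcontfun ` D)"
  proof clarify
    fix z :: 'a
    have "\<exists>y\<in>dist_bcontfun ` D. dist y (dist_bcontfun z) < e" if "0 < e" for e
    proof -
      obtain d where d: "d \<in> D" "dist z d < e / 2"
        using D(2)[of "ball z (e / 2)"] \<open>0 < e\<close> by auto
      have "dist (dist_bcontfun d) (dist_bcontfun z) \<le> e / 2"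
      proof (rule dist_bound)
        fix x
        have "\<bar>dist x d - dist x z\<bar> \<le> dist z d" by metric
        then show "dist (apply_bcontfun (dist_bcontfun d) x) (apply_bcontfun (dist_bcontfun z) x) \<le> e / 2"
          using d(2) by (simp add: apply_dist_bcontfun[OF bdd] dist_real_def)
      qed
      then show ?thesis using d(1) \<open>0 < e\<close> by force
    qed
    then show "dist_bcontfun z \<in> closure (dist_bcontfun ` D)"
      by (simp add: closure_approachable)
  qed
  have "inj_on ?F (characters ?A)"
  proof (rule inj_onI)
    fix \<xi> \<eta> assume \<xi>: "\<xi> \<in> characters ?A" "\<eta> \<in> characters ?A" and eq: "?F \<xi> = ?F \<eta>"
    have "\<xi> (dist_bcontfun z) = \<eta> (dist_bcontfun z)" if "z \<in> D" for z
      using fun_cong[OF eq, of z] that by simp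
    then show "\<xi> = \<eta>"
      using characters_eqI[of \<xi> "range dist_bcontfun" \<eta> "dist_bcontfun ` D"] \<xi> dense dA
      by (auto simp: gromov_algebra_eq[OF bdd])
  qed
  moreover have "continuous_map (character_topology ?A) ?Y ?F"
    by (auto simp: continuous_map_componentwise continuous_map_character_apply[OF A dA])
  moreover have "metrizable_space ?Y"
    using D(1) by (simp add: metrizable_space_product_topology metrizable_space_euclidean)
  ultimately show ?thesis
    using metrizable_space_compact_injection[OF compact_space_character_topology[OF A]]
      topspace_character_topology[OF A] unfolding gromov_compactification_def by metis
qed

lemma greatest_equivariant_compactification_gromov:
  assumes "urysohn_sphere TYPE('a::polish_space)"
  shows "greatest_equivariant_compactification TYPE('k) (Iso :: ('a \<Rightarrow> 'a) monoid) Iso_topology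
    euclidean (\<lambda>g. g) gromov_compactification (character_action (\<lambda>g. g) gromov_algebra) gromov_map"
  using greatest_equivariant_compactification_RUC[OF G_space_Iso[where 'a = 'a]]
  unfolding urysohn_RUC_eq_gromov_algebra[OF assms] gromov_compactification_def gromov_map_def .

theorem theorem3p6:
  assumes "urysohn_sphere TYPE('a::polish_space)"
  shows "(\<exists>\<psi>. greatest_equivariant_compactification TYPE('k)
             (Iso :: ('a \<Rightarrow> 'a) monoid) Iso_topology euclidean (\<lambda>g. g)
             gromov_compactification \<psi> gromov_map)
    \<and> (\<forall>(K :: 'l topology) \<psi> \<nu>.
         greatest_equivariant_compactification TYPE(('a \<Rightarrow>\<^sub>C real) \<Rightarrow> real)
             (Iso :: ('a \<Rightarrow> 'a) monoid) Iso_topology euclidean (\<lambda>g. g) K \<psi> \<nu>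
         \<longrightarrow> compactification_equivalent euclidean K \<nu> gromov_compactification gromov_map
             \<and> metrizable_space K)
    \<and> RUC (Iso :: ('a \<Rightarrow> 'a) monoid) Iso_topology (\<lambda>g. g) =
        closed_unital_algebra_generated
          {f. \<exists>z::'a. apply_bcontfun f = (\<lambda>x. dist x z)}"
proof (intro conjI allI impI)
  let ?G = "Iso :: ('a \<Rightarrow> 'a) monoid"
  note RUC_eq = urysohn_RUC_eq_gromov_algebra[OF assms]
  note greatest = greatest_equivariant_compactification_gromov[OF assms]
  show "\<exists>\<psi>. greatest_equivariant_compactification TYPE('k) ?G Iso_topology euclidean (\<lambda>g. g)
      gromov_compactification \<psi> gromov_map"
    using greatest by blast
  show "RUC ?G Iso_topology (\<lambda>g. g) =
      closed_unital_algebra_generated {f. \<exists>z::'a. apply_bcontfun f = (\<lambda>x. dist x z)}"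
    using RUC_eq by (simp add: gromov_algebra_def)
  fix K :: "'l topology" and \<psi> \<nu>
  assume K: "greatest_equivariant_compactification TYPE(('a \<Rightarrow>\<^sub>C real) \<Rightarrow> real)
    ?G Iso_topology euclidean (\<lambda>g. g) K \<psi> \<nu>"
  then have eK: "equivariant_compactification ?G Iso_topology euclidean (\<lambda>g. g) K \<psi> \<nu>"
    by (simp add: greatest_equivariant_compactification_def)
  \<comment> \<open>The Gromov compactification lives on the very type over which \<open>K\<close>
    is assumed greatest, so it is one of the competitors of \<open>K\<close>.\<close>
  have 1: "compactification_factor euclidean (gromov_compactification) gromov_map K \<nu>"
    using K greatest unfolding greatest_equivariant_compactification_def by blast
  \<comment> \<open>Here \<open>K\<close> is the competitor, and the Gromov compactification is
    taken as greatest over the type of \<open>K\<close>.\<close>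
  have 2: "compactification_factor euclidean K \<nu> gromov_compactification gromov_map"
    using eK greatest[where 'k = 'l] unfolding greatest_equivariant_compactification_def by blast
  show "compactification_equivalent euclidean K \<nu> gromov_compactification gromov_map"
    using 1 2 by (simp add: compactification_equivalent_def)
  obtain \<rho> where \<rho>: "continuous_map K gromov_compactification \<rho>" "\<And>x. \<rho> (\<nu> x) = gromov_map x"
    using 1 by (auto simp: compactification_factor_def)
  obtain \<pi> where \<pi>: "continuous_map gromov_compactification K \<pi>" "\<And>x. \<pi> (gromov_map x) = \<nu> x"
    using 2 by (auto simp: compactification_factor_def)
  have K': "compact_space K" "Hausdorff_space K" "K closure_of range \<nu> = topspace K"
    using eK by (auto simp: equivariant_compactification_def G_space_def)
  \<comment> \<open>The composition fixes the dense image of \<open>\<nu>\<close>, hence all of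
    \<open>K\<close>. So \<open>\<rho>\<close> is injective, and metrizability passes from the
    Gromov compactification to \<open>K\<close>.\<close>
  have "(\<pi> \<circ> \<rho>) p = id p" if "p \<in> topspace K" for p
  proof (rule forall_in_closure_of_eq[where f = "\<pi> \<circ> \<rho>" and g = id])
    show "continuous_map K K (\<pi> \<circ> \<rho>)" by (rule continuous_map_compose[OF \<rho>(1) \<pi>(1)])
    show "p \<in> K closure_of range \<nu>" using that K'(3) by simp
  qed (use K' \<rho>(2) \<pi>(2) in auto)
  then have "inj_on \<rho> (topspace K)"
    by (intro inj_on_inverseI[where g = \<pi>]) simp
  then show "metrizable_space K"
    using metrizable_space_compact_injection[OF K'(1) metrizable_gromov_compactification \<rho>(1)] assms
    by (simp add: urysohn_sphere_def)
qed

end
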